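(* Let $\Gamma$ be a discrete abelian group with $A, B\subseteq \Gamma$ nonempty, and let $K\leq \Gamma$ be a finite index subgroup such that $K$ is the stabilizer of $A+B+K$ and such that for every extreme invariant mean $\nu$ on $\ell^\infty(\Gamma)$ with $\nu(A+B)<\nu(A)+\nu(B)$ one has $\nu(A+B)=\nu(A+B+K)$ and $\nu(A+B+K)=\nu(A+K)+\nu(B+K)-\nu(K)$. Let $k:=[\Gamma:K]$. If $m$ is an invariant mean on $\ell^\infty(\Gamma)$ satisfying $\delta:=m(A)+m(B)-m(A+B)>0$, then there is an invariant mean $m'$ on $\ell^\infty(\Gamma)$ such that \begin{enumerate} \item $m'$ is a $k\delta$-restriction of $m$; \item $m'(A+B)=m'(A+B+K)$; \item $m'(A)+m'(B)-m'(A+B)\geq \delta.$ \end{enumerate}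
   Context: A mean on $\ell^\infty(\Gamma)$ is a linear functional $m$ with $m(1_\Gamma)=1$ and $m(f)\ge0$ for $f:\Gamma\to[0,1]$; $m(C):=m(1_C)$. Invariant: $m(\tau_\gamma f)=m(f)$ with $(\tau_\gamma f)(x)=f(x-\gamma)$. Extreme invariant means are extreme points of the weak$^*$-compact convex set of invariant means. The stabilizer of $C$ is $\{\gamma:C+\gamma=C\}$. For means $m,m'$ and $\beta>0$, $m'$ is a $\beta$-restriction of $m$ if there is a sequence of sets $C_n\subseteq\Gamma$ with $\lim_{n\to\infty}m(C_n)\ge\beta$, $\lim_{N\to\infty}\sup_{n,n'\ge N}m(C_n\triangle C_{n'})=0$, and $m'(f)=\lim_{n\to\infty}m(C_n)^{-1}m(f1_{C_n})$ for all $f\in\ell^\infty(\Gamma)$. *)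

theory Defs
  imports "HOL-Analysis.Analysis" "HOL-Library.Set_Algebras"
begin

unbundle bcontfun.lifting

text \<open>
  A discrete abelian group is a type of class \<^class>\<open>ab_group_add\<close> and \<^class>\<open>discrete_topology\<close>.
  On such a type every function is continuous, so \<open>'a \<Rightarrow>\<^sub>C real\<close> is the space
  of all bounded real functions with the supremum norm.  Functionals live in the normed
  dual \<open>('a \<Rightarrow>\<^sub>C real) \<Rightarrow>\<^sub>L real\<close>; the lemma \<open>linear_mean_bounded\<close>
  below shows that building continuity into the type excludes no mean.
\<close>

lemma bcontfun_discrete_iff:
  "(f :: 'a::discrete_topology \<Rightarrow> 'b::metric_space) \<in> bcontfun \<longleftrightarrow> bounded (range f)"
  by (auto simp: bcontfun_def continuous_on_open_invariant intro: open_discrete)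

lift_definition ind_fun :: "'a::discrete_topology set \<Rightarrow> ('a \<Rightarrow>\<^sub>C real)"
  is "\<lambda>C. indicator C"
  by (auto simp: bcontfun_discrete_iff bounded_iff indicator_def intro!: exI[of _ 1])

lift_definition translate ::
    "'a::{ab_group_add,discrete_topology} \<Rightarrow> ('a \<Rightarrow>\<^sub>C real) \<Rightarrow> ('a \<Rightarrow>\<^sub>C real)"
  is "\<lambda>\<gamma> f x. f (x - \<gamma>)"
  by (auto simp: bcontfun_discrete_iff intro: bounded_subset)

lift_definition restrict_fun ::
    "'a::discrete_topology set \<Rightarrow> ('a \<Rightarrow>\<^sub>C real) \<Rightarrow> ('a \<Rightarrow>\<^sub>C real)"
  is "\<lambda>C f x. f x * indicator C x"
proof -
  fix C :: "'a set" and f :: "'a \<Rightarrow> real"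
  assume "f \<in> bcontfun"
  then obtain M where "\<And>x. \<bar>f x\<bar> \<le> M"
    by (auto simp: bcontfun_def bounded_iff)
  then have "\<bar>f x * indicator C x\<bar> \<le> max 0 M" for x
    by (auto simp: indicator_def le_max_iff_disj)
  then show "(\<lambda>x. f x * indicator C x) \<in> bcontfun"
    unfolding bcontfun_discrete_iff bounded_iff by auto
qed

definition is_mean :: "(('a::discrete_topology \<Rightarrow>\<^sub>C real) \<Rightarrow>\<^sub>L real) \<Rightarrow> bool" where
  "is_mean m \<longleftrightarrow> m (ind_fun UNIV) = 1 \<and>
     (\<forall>f. (\<forall>x. apply_bcontfun f x \<in> {0..1}) \<longrightarrow> 0 \<le> m f)"

lemma linear_mean_bounded:
  fixes \<phi> :: "('a::discrete_topology \<Rightarrow>\<^sub>C real) \<Rightarrow> real"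
  assumes lin: "linear \<phi>" and one: "\<phi> (ind_fun UNIV) = 1"
    and pos: "\<And>f. (\<And>x. apply_bcontfun f x \<in> {0..1}) \<Longrightarrow> 0 \<le> \<phi> f"
  shows "bounded_linear \<phi>"
proof -
  interpret linear \<phi> by fact
  have lower: "- norm f \<le> \<phi> f" for f
  proof (cases "f = 0")
    case False
    then have n: "norm f > 0" by simp
    let ?h = "(1 / (2 * norm f)) *\<^sub>R f + (1/2) *\<^sub>R ind_fun UNIV"
    have "apply_bcontfun ?h x \<in> {0..1}" for x
    proof -
      have "\<bar>apply_bcontfun f x\<bar> \<le> norm f"
        using norm_bounded[of f x] by simp
      with n show ?thesis
        by (auto simp: ind_fun.rep_eq plus_bcontfun.rep_eq scaleR_bcontfun.rep_eq
              field_simps abs_le_iff)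
    qed
    then have "0 \<le> \<phi> ?h" by (rule pos)
    also have "\<phi> ?h = \<phi> f / (2 * norm f) + 1/2"
      by (simp add: add scaleR one)
    finally show ?thesis using n by (simp add: field_simps)
  qed (simp add: zero)
  have "norm (\<phi> f) \<le> norm f * 1" for f
    using lower[of f] lower[of "- f"] by (simp add: neg abs_le_iff)
  then show ?thesis
    by (intro bounded_linear.intro lin bounded_linear_axioms.intro exI[of _ 1] allI)
qed

definition meas :: "(('a::discrete_topology \<Rightarrow>\<^sub>C real) \<Rightarrow>\<^sub>L real) \<Rightarrow> 'a set \<Rightarrow> real" where
  "meas m C = m (ind_fun C)"

definition invariant_means ::
    "(('a::{ab_group_add,discrete_topology} \<Rightarrow>\<^sub>C real) \<Rightarrow>\<^sub>L real) set" where
  "invariant_means = {m. is_mean m \<and> (\<forall>\<gamma> f. m (translate \<gamma> f) = m f)}"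

definition is_restriction ::
    "real \<Rightarrow> (('a::discrete_topology \<Rightarrow>\<^sub>C real) \<Rightarrow>\<^sub>L real) \<Rightarrow>
     (('a \<Rightarrow>\<^sub>C real) \<Rightarrow>\<^sub>L real) \<Rightarrow> bool" where
  "is_restriction \<beta> m m' \<longleftrightarrow> 0 < \<beta> \<and> is_mean m \<and> is_mean m' \<and>
     (\<exists>C :: nat \<Rightarrow> 'a set.
        (\<exists>c. (\<lambda>n. meas m (C n)) \<longlonglongrightarrow> c \<and> \<beta> \<le> c) \<and>
        (\<lambda>N. SUP (n, n') \<in> {N..} \<times> {N..}. meas m (sym_diff (C n) (C n'))) \<longlonglongrightarrow> 0 \<and>
        (\<forall>f. (\<lambda>n. inverse (meas m (C n)) * m (restrict_fun (C n) f)) \<longlonglongrightarrow> m' f))"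

definition is_subgroup :: "'a::ab_group_add set \<Rightarrow> bool" where
  "is_subgroup K \<longleftrightarrow> 0 \<in> K \<and> (\<forall>x\<in>K. \<forall>y\<in>K. x + y \<in> K) \<and> (\<forall>x\<in>K. - x \<in> K)"

definition cosets :: "'a::ab_group_add set \<Rightarrow> 'a set set" where
  "cosets K = range (\<lambda>\<gamma>. \<gamma> +o K)"

definition stabilizer :: "'a::ab_group_add set \<Rightarrow> 'a set" where
  "stabilizer C = {\<gamma>. \<gamma> +o C = C}"

end

(*
  Put F = 1_A + 1_B - 1_(A+B) and G = 1_(A+B+K) - 1_(A+B).  Every extreme invariant mean nu with
  nu(F) > 0 has nu(G) = 0 and nu(F) <= nu(K) = 1/k.  An inequality nu(g) >= 0 that holds at the extreme
  points holds for all invariant means, as nu |-> nu(g) attains its minimum over the weak* compact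
  set of invariant means at an extreme point.  Hence nu(F) <= 1/k always.  Moreover,
  nu((f - c)^2) >= c^2 nu(G) for all c > 0 and every bounded f that has the same integral as F
  against each invariant mean.

  Let f_n be averages of F that minimize the second moment under m asymptotically.  They are Cauchy in
  L^1(m) and asymptotically invariant; their limit plays the role of the conditional expectation P F
  on the invariant sets.  Applying the square inequality to the restrictions of m to thin
  slices {c <= P F <= c + w} shows that G vanishes m-almost everywhere on {P F > 0}.  So m' is the
  restriction of m to {P F > 0}: with p = m(P F > 0) one has delta <= p m'(F) <= p/k.
*)
theory Submission
  imports Defs
begin

subsection \<open>Extreme points of weak* compact sets\<close>

text \<open>The implication from \<open>\<nu>(F) > 0\<close> to \<open>\<nu>(G) = 0\<close> is not a
  linear condition, so it does not pass from extreme means to mixtures of them: one component may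
  carry the positive part of F and another one the mass of G. The square inequality is a linear
  substitute that does pass. It is informative only if f stays close to c, which explains two
  features of the proof. F itself has integer values, so it must be replaced by averages, which
  approach a function that is invariant in the limit; and m must be cut into slices. On a slice of
  width w at level c the inequality bounds G by (w/c)^2, a square, so the total error vanishes as
  the mesh is refined even though the number of slices grows. A further obstacle is that a mean is
  only finitely additive, so \<open>P F\<close> is not constructed as a function on the group. All
  statements are made for f_n with a limit in n, and slices are cut by Lipschitz weights, because
  L^1(m) estimates pass through these but not through indicators. Only the last set {P F > 0} has to
  be given by indicators, and there the thresholds must shrink slowly compared with the Cauchy
  rate.\<close>

definition weak_face ::
    "('b::real_normed_vector \<Rightarrow>\<^sub>L real) set \<Rightarrow> ('b \<Rightarrow>\<^sub>L real) set \<Rightarrow> bool" where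
  "weak_face S T \<longleftrightarrow> T \<subseteq> S \<and> T \<noteq> {} \<and> compact (blinfun_apply ` T) \<and>
     (\<forall>a\<in>S. \<forall>b\<in>S. open_segment a b \<inter> T \<noteq> {} \<longrightarrow> a \<in> T \<and> b \<in> T)"

lemma weak_faceD:
  assumes "weak_face S T" "a \<in> S" "b \<in> S" "z \<in> open_segment a b" "z \<in> T"
  shows "a \<in> T \<and> b \<in> T"
  using assms by (auto simp: weak_face_def)

lemma weak_faceI:
  assumes "T \<subseteq> S" "T \<noteq> {}" "compact (blinfun_apply ` T)"
    and "\<And>a b z. a \<in> S \<Longrightarrow> b \<in> S \<Longrightarrow> z \<in> open_segment a b \<Longrightarrow> z \<in> T \<Longrightarrow> a \<in> T \<and> b \<in> T"
  shows "weak_face S T"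
  using assms unfolding weak_face_def by (metis disjoint_iff)

text \<open>A proper weighted average of two values, each at least the minimum, can equal the
  minimum only if both values do. Compactness survives because the condition is closed in the single
  coordinate \<open>g\<close>.\<close>

lemma weak_face_argmin:
  fixes S T :: "('b::real_normed_vector \<Rightarrow>\<^sub>L real) set"
  assumes T: "weak_face S T"
  shows "weak_face S {x\<in>T. \<forall>y\<in>T. blinfun_apply x g \<le> blinfun_apply y g}" (is "weak_face S ?M")
proof -
  have TS: "T \<subseteq> S" and ne: "T \<noteq> {}" and cpt: "compact (blinfun_apply ` T)"
    using T by (auto simp: weak_face_def)
  have cont: "continuous_on A (\<lambda>h. h g)" for A :: "('b \<Rightarrow> real) set"
    by (rule continuous_on_subset[OF continuous_on_product_coordinates]) simp
  obtain x where x: "x \<in> T" "\<And>y. y \<in> T \<Longrightarrow> blinfun_apply x g \<le> blinfun_apply y g"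
    using continuous_attains_inf[OF cpt _ cont] ne by auto
  have M: "?M = {y\<in>T. blinfun_apply y g \<le> blinfun_apply x g}"
    using x by (auto intro: order_trans)
  have "compact (blinfun_apply ` T \<inter> {h. h g \<le> blinfun_apply x g})"
    by (intro compact_Int_closed cpt closed_Collect_le cont continuous_on_const)
  moreover have "blinfun_apply ` ?M = blinfun_apply ` T \<inter> {h. h g \<le> blinfun_apply x g}"
    unfolding M by auto
  moreover have "a \<in> ?M \<and> b \<in> ?M"
    if ab: "a \<in> S" "b \<in> S" and z: "z \<in> open_segment a b" "z \<in> ?M" for a b z
  proof -
    from weak_faceD[OF T ab z(1)] z(2) have abT: "a \<in> T" "b \<in> T" by auto
    obtain u where u: "0 < u" "u < 1" "z = (1 - u) *\<^sub>R a + u *\<^sub>R b"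
      using z(1) by (auto simp: in_segment)
    define p q r where "p = blinfun_apply a g" and "q = blinfun_apply b g" and "r = blinfun_apply x g"
    have pq: "r \<le> p" "r \<le> q" using x(2) abT by (auto simp: p_def q_def r_def)
    have "(1 - u) * p + u * q \<le> r"
      using z(2) u(3) unfolding M
      by (simp add: p_def q_def r_def plus_blinfun.rep_eq scaleR_blinfun.rep_eq)
    then have s: "(1 - u) * (p - r) + u * (q - r) \<le> 0" by (simp add: algebra_simps)
    have "0 \<le> (1 - u) * (p - r)" "0 \<le> u * (q - r)" using u pq by auto
    with s have "(1 - u) * (p - r) = 0" "u * (q - r) = 0" by linarith+
    then have "p = r" "q = r" using u by auto
    then show ?thesis using abT unfolding M p_def q_def r_def by simp
  qed
  moreover have "x \<in> ?M" using x by simp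
  ultimately show ?thesis using TS by (intro weak_faceI) auto
qed

lemma compact_imp_closed_fun:
  fixes X :: "('b \<Rightarrow> real) set"
  assumes "compact X"
  shows "closed X"
proof -
  have "Hausdorff_space (euclidean :: ('b \<Rightarrow> real) topology)"
    unfolding euclidean_product_topology[symmetric] by (simp add: Hausdorff_space_product_topology)
  then show ?thesis using assms by (metis closed_closedin compactin_euclidean_iff compactin_imp_closedin)
qed

text \<open>Zorn's lemma yields a minimal weak face inside the face where \<open>g\<close> is least,
  and a minimal face is a single point. Compactness is required of the image under
  \<open>blinfun_apply\<close>, that is, for pointwise convergence, since the type of functionals
  itself carries the norm topology.\<close>

lemma extreme_point_minimizing:
  fixes S :: "('b::real_normed_vector \<Rightarrow>\<^sub>L real) set"
  assumes cpt: "compact (blinfun_apply ` S)" and ne: "S \<noteq> {}"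
  obtains e where "e extreme_point_of S"
    and "\<And>x. x \<in> S \<Longrightarrow> blinfun_apply e g \<le> blinfun_apply x g"
proof -
  define S0 where "S0 = {x\<in>S. \<forall>y\<in>S. blinfun_apply x g \<le> blinfun_apply y g}"
  define \<F> where "\<F> = {T. weak_face S T \<and> T \<subseteq> S0}"
  have \<F>_ne: "T \<noteq> {}" if "T \<in> \<F>" for T
    using that by (simp add: \<F>_def weak_face_def)
  have "weak_face S S" using assms by (auto simp: weak_face_def)
  then have S0: "S0 \<in> \<F>" using weak_face_argmin unfolding \<F>_def S0_def by blast
  have "\<exists>M\<in>\<F>. \<forall>T\<in>\<F>. M \<supseteq> T \<longrightarrow> T = M"
  proof (rule predicate_Zorn[where P="(\<supseteq>)"])
    show "partial_order_on \<F> (relation_of (\<supseteq>) \<F>)"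
      by (rule partial_order_on_relation_ofI) auto
    fix C assume C: "C \<in> Chains (relation_of (\<supseteq>) \<F>)"
    show "\<exists>U\<in>\<F>. \<forall>T\<in>C. T \<supseteq> U"
    proof (cases "C = {}")
      case True then show ?thesis using S0 by blast
    next
      case False
      have CF: "C \<subseteq> \<F>" and lin: "\<And>X Y. X \<in> C \<Longrightarrow> Y \<in> C \<Longrightarrow> X \<subseteq> Y \<or> Y \<subseteq> X"
        using C by (auto simp: Chains_def relation_of_def)
      have cptC: "compact (blinfun_apply ` T)" if "T \<in> C" for T
        using CF that by (auto simp: \<F>_def weak_face_def)
      obtain T0 where T0: "T0 \<in> C" using False by blast
      have img: "blinfun_apply ` \<Inter> C = (\<Inter>T\<in>C. blinfun_apply ` T)"
        using T0 by (intro image_INT[where B="\<lambda>x. x" and C=UNIV, simplified]) (auto simp: inj_def blinfun_apply_inject)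
      \<comment> \<open>Finite intersection property inside the compact image of \<open>T0\<close>:
        a finite subfamily of a chain has a least member, which is a face and so nonempty.\<close>
      have "(blinfun_apply ` T0) \<inter> (\<Inter>T\<in>C. blinfun_apply ` T) \<noteq> {}"
      proof (rule compact_imp_fip_image)
        show "compact (blinfun_apply ` T0)" by (rule cptC[OF T0])
        show "closed (blinfun_apply ` T)" if "T \<in> C" for T
          by (rule compact_imp_closed_fun[OF cptC[OF that]])
        fix D assume D: "finite D" "D \<subseteq> C"
        have "\<Inter>(insert T0 D) \<in> insert T0 D"
          using D T0 lin by (intro Inter_in_chain[where \<A>=UNIV]) (auto simp: subset_chain_def)
        moreover have "insert T0 D \<subseteq> \<F>" using D T0 CF by (simp add: subset_iff)
        ultimately have "\<Inter>(insert T0 D) \<in> \<F>" by (rule rev_subsetD)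
        then have "\<Inter>(insert T0 D) \<noteq> {}" by (rule \<F>_ne)
        then obtain z where z: "z \<in> \<Inter>(insert T0 D)" unfolding ex_in_conv[symmetric] by (elim exE)
        then have "blinfun_apply z \<in> (blinfun_apply ` T0) \<inter> (\<Inter>T\<in>D. blinfun_apply ` T)" by simp
        then show "(blinfun_apply ` T0) \<inter> (\<Inter>T\<in>D. blinfun_apply ` T) \<noteq> {}"
          by (metis empty_iff)
      qed
      then have "\<Inter>C \<noteq> {}" unfolding img[symmetric] by (metis image_empty inf_bot_right)
      moreover have "compact (blinfun_apply ` \<Inter>C)"
      proof -
        have "blinfun_apply ` \<Inter>C = blinfun_apply ` T0 \<inter> (\<Inter>T\<in>C. blinfun_apply ` T)"
          unfolding img using T0 by (intro Int_absorb1[symmetric] INT_lower)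
        also have "compact \<dots>"
          by (intro compact_Int_closed closed_INT ballI cptC[OF T0] compact_imp_closed_fun cptC)
        finally show ?thesis .
      qed
      moreover have "T0 \<subseteq> S" "T0 \<subseteq> S0" using CF T0 by (auto simp: \<F>_def weak_face_def)
      then have "\<Inter>C \<subseteq> S" and sub0: "\<Inter>C \<subseteq> S0" using T0 by auto
      ultimately have "weak_face S (\<Inter>C)"
      proof (intro weak_faceI)
        fix a b z assume ab: "a \<in> S" "b \<in> S" "z \<in> open_segment a b" "z \<in> \<Inter>C"
        have "a \<in> T \<and> b \<in> T" if T: "T \<in> C" for T
        proof (rule weak_faceD[OF _ ab(1-3)])
          show "weak_face S T" using CF T by (auto simp: \<F>_def)
        qed (use ab T in simp)
        then show "a \<in> \<Inter>C \<and> b \<in> \<Inter>C" by simp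
      qed
      then have "\<Inter>C \<in> \<F>" using sub0 by (simp add: \<F>_def)
      then show ?thesis by (intro bexI[of _ "\<Inter>C"]) auto
    qed
  qed
  then obtain M where "M \<in> \<F>" and minF: "\<forall>T\<in>\<F>. T \<subseteq> M \<longrightarrow> T = M" by (elim bexE)
  then have M: "weak_face S M" "M \<subseteq> S0" by (simp_all add: \<F>_def)
  have min: "T = M" if "weak_face S T" "T \<subseteq> M" for T
    using minF that M(2) order_trans[of T M S0] by (simp add: \<F>_def)
  obtain e where e: "e \<in> M" using M(1) by (metis ex_in_conv weak_face_def)
  have "x = e" if "x \<in> M" for x
  proof (rule blinfun_eqI)
    fix f
    \<comment> \<open>Minimizing the evaluation at \<open>f\<close> over \<open>M\<close> gives a
      face inside \<open>M\<close>, hence all of \<open>M\<close>. So every evaluation is constant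
      on \<open>M\<close>, and evaluations separate functionals.\<close>
    have "{x\<in>M. \<forall>y\<in>M. blinfun_apply x f \<le> blinfun_apply y f} = M"
      by (rule min[OF weak_face_argmin[OF M(1)]]) auto
    then have "\<forall>x\<in>M. \<forall>y\<in>M. blinfun_apply x f \<le> blinfun_apply y f" by auto
    then show "blinfun_apply x f = blinfun_apply e f"
      using that e by (simp add: antisym)
  qed
  then have "M = {e}" using e by (intro equalityI subsetI; blast)
  have "e \<in> S0" using e M(2) by (rule rev_subsetD)
  have "e \<notin> open_segment a b" if "a \<in> S" "b \<in> S" for a b
  proof
    assume "e \<in> open_segment a b"
    moreover from weak_faceD[OF M(1) that this e] have "a \<in> M" "b \<in> M" by auto
    ultimately show False using \<open>M = {e}\<close> by simp
  qed
  then have "e extreme_point_of S"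
    using \<open>e \<in> S0\<close> by (simp add: extreme_point_of_def S0_def)
  then show thesis using \<open>e \<in> S0\<close> that unfolding S0_def by blast
qed

subsection \<open>Means as expectations\<close>

text \<open>Lets a functional act on plain functions, so that integrands can be written as lambda
  terms. The value is meaningful only for members of \<open>bcontfun\<close>, hence the membership
  premises throughout.\<close>

definition expect :: "(('a::discrete_topology \<Rightarrow>\<^sub>C real) \<Rightarrow>\<^sub>L real) \<Rightarrow> ('a \<Rightarrow> real) \<Rightarrow> real" where
  "expect m f = m (Bcontfun f)"

lemma bcontfun_discrete_real_iff:
  "(f :: 'a::discrete_topology \<Rightarrow> real) \<in> bcontfun \<longleftrightarrow> (\<exists>B. \<forall>x. \<bar>f x\<bar> \<le> B)"
  by (auto simp: bcontfun_discrete_iff bounded_iff)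

lemma bcontfun_discreteI:
  fixes f :: "'a::discrete_topology \<Rightarrow> real"
  shows "(\<And>x. \<bar>f x\<bar> \<le> B) \<Longrightarrow> f \<in> bcontfun"
  by (auto simp: bcontfun_discrete_real_iff)

lemma bcontfun_discreteE:
  fixes f :: "'a::discrete_topology \<Rightarrow> real"
  assumes "f \<in> bcontfun"
  obtains B where "0 \<le> B" "\<And>x. \<bar>f x\<bar> \<le> B"
proof -
  obtain B where "\<And>x. \<bar>f x\<bar> \<le> B" using assms by (auto simp: bcontfun_discrete_real_iff)
  then show thesis by (intro that[of B]) (auto intro: order_trans[OF abs_ge_zero])
qed

context
  fixes f g :: "'a::discrete_topology \<Rightarrow> real"
  assumes fg: "f \<in> bcontfun" "g \<in> bcontfun"
begin

lemma bcontfun_mult: "(\<lambda>x. f x * g x) \<in> bcontfun"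
proof -
  obtain B C where "0 \<le> B" "\<And>x. \<bar>f x\<bar> \<le> B" "\<And>x. \<bar>g x\<bar> \<le> C"
    using fg by (metis bcontfun_discreteE)
  then show ?thesis
    by (intro bcontfun_discreteI[of _ "B * C"]) (simp add: abs_mult mult_mono)
qed

lemma bcontfun_max: "(\<lambda>x. max (f x) (g x)) \<in> bcontfun"
proof -
  obtain B C where "0 \<le> B" "0 \<le> C" "\<And>x. \<bar>f x\<bar> \<le> B" "\<And>x. \<bar>g x\<bar> \<le> C"
    using fg by (metis bcontfun_discreteE)
  then show ?thesis
    by (intro bcontfun_discreteI[of _ "B + C"]) (smt (verit))
qed

end

lemma bcontfun_abs: "f \<in> bcontfun \<Longrightarrow> (\<lambda>x. \<bar>f x\<bar>) \<in> bcontfun"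
  for f :: "'a::discrete_topology \<Rightarrow> real"
  by (auto simp: bcontfun_discrete_real_iff)

lemma bcontfun_power: "f \<in> bcontfun \<Longrightarrow> (\<lambda>x. f x ^ n) \<in> bcontfun"
  for f :: "'a::discrete_topology \<Rightarrow> real"
  by (induction n) (auto intro: bcontfun_mult const_bcontfun)

lemma bcontfun_indicator: "(indicator C :: 'a::discrete_topology \<Rightarrow> real) \<in> bcontfun"
  by (rule bcontfun_discreteI[of _ 1]) (auto simp: indicator_def)

lemma bcontfun_shift: "f \<in> bcontfun \<Longrightarrow> (\<lambda>x. f (x - \<gamma>)) \<in> bcontfun"
  for f :: "'a::{ab_group_add,discrete_topology} \<Rightarrow> real"
  by (auto simp: bcontfun_discrete_real_iff)

lemma bcontfun_sum: "(\<And>i. i \<in> I \<Longrightarrow> f i \<in> bcontfun) \<Longrightarrow> (\<lambda>x. \<Sum>i\<in>I. f i x) \<in> bcontfun"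
  for f :: "'i \<Rightarrow> 'a::discrete_topology \<Rightarrow> real"
  by (induction I rule: infinite_finite_induct) (auto intro: plus_cont const_bcontfun)

lemmas bcontfun_intros = const_bcontfun apply_bcontfun bcontfun_mult bcontfun_max bcontfun_abs bcontfun_power
  bcontfun_indicator bcontfun_shift bcontfun_sum plus_cont minus_cont uminus_cont

lemma expect_apply [simp]: "expect m (apply_bcontfun f) = m f"
  by (simp add: expect_def apply_bcontfun_inverse)

lemma meas_eq_expect: "meas m C = expect m (indicator C)"
  unfolding meas_def by (metis expect_apply ind_fun.rep_eq)

lemma expect_restrict_fun: "blinfun_apply m (restrict_fun C f) = expect m (\<lambda>x. f x * indicator C x)"
  by (simp only: restrict_fun.rep_eq[symmetric] expect_apply)

context
  fixes m :: "('a::discrete_topology \<Rightarrow>\<^sub>C real) \<Rightarrow>\<^sub>L real"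
begin

lemma expect_add:
  assumes "f \<in> bcontfun" "g \<in> bcontfun"
  shows "expect m (\<lambda>x. f x + g x) = expect m f + expect m g"
proof -
  obtain f' g' where [simp]: "f = apply_bcontfun f'" "g = apply_bcontfun g'"
    using assms by (metis bcontfunE)
  have "expect m (\<lambda>x. f x + g x) = expect m (apply_bcontfun (f' + g'))"
    by (simp add: plus_bcontfun.rep_eq[abs_def])
  then show ?thesis by (simp add: blinfun.add_right del: plus_bcontfun.rep_eq)
qed

lemma expect_cmult:
  assumes "f \<in> bcontfun"
  shows "expect m (\<lambda>x. a * f x) = a * expect m f"
proof -
  obtain f' where [simp]: "f = apply_bcontfun f'"
    using assms by (metis bcontfunE)
  have "expect m (\<lambda>x. a * f x) = expect m (apply_bcontfun (a *\<^sub>R f'))"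
    by (simp add: scaleR_bcontfun.rep_eq[abs_def])
  then show ?thesis by (simp add: blinfun.scaleR_right del: scaleR_bcontfun.rep_eq)
qed

lemma expect_diff:
  assumes "f \<in> bcontfun" "g \<in> bcontfun"
  shows "expect m (\<lambda>x. f x - g x) = expect m f - expect m g"
  using expect_add[OF assms(1) uminus_cont[OF assms(2)]] expect_cmult[OF assms(2), of "-1"]
  by simp

lemma expect_sum:
  assumes "\<And>i. i \<in> I \<Longrightarrow> f i \<in> bcontfun"
  shows "expect m (\<lambda>x. \<Sum>i\<in>I. f i x) = (\<Sum>i\<in>I. expect m (f i))"
  using assms
proof (induction I rule: infinite_finite_induct)
  case (insert i I)
  then show ?case by (simp add: expect_add bcontfun_sum)
qed (use expect_cmult[OF const_bcontfun, of 0 0] in simp_all)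

context
  assumes mean: "is_mean m"
begin

lemma expect_const [simp]: "expect m (\<lambda>x. c) = c"
proof -
  have "expect m (\<lambda>x. c * indicator UNIV x) = c * meas m UNIV"
    by (simp only: expect_cmult[OF bcontfun_indicator] meas_eq_expect)
  then show ?thesis using mean by (simp add: is_mean_def meas_def)
qed

lemma expect_nonneg:
  assumes f: "f \<in> bcontfun" and pos: "\<And>x. 0 \<le> f x"
  shows "0 \<le> expect m f"
proof -
  obtain B where B: "0 \<le> B" "\<And>x. \<bar>f x\<bar> \<le> B" using bcontfun_discreteE[OF f] by blast
  \<comment> \<open>Positivity of a mean is given only for functions into [0,1], so \<open>f\<close>
    is scaled down; \<open>B + 1\<close> avoids division by zero when \<open>B = 0\<close>.\<close>
  have b: "(\<lambda>x. 1 / (B + 1) * f x) \<in> bcontfun" by (intro bcontfun_intros f)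
  then obtain h where h: "(\<lambda>x. 1 / (B + 1) * f x) = apply_bcontfun h" by (metis bcontfunE)
  have "apply_bcontfun h x \<in> {0..1}" for x
    unfolding h[symmetric] using B(1) B(2)[of x] pos[of x] by (simp add: divide_le_eq)
  then have "0 \<le> m h" using mean by (auto simp: is_mean_def)
  also have "m h = 1 / (B + 1) * expect m f" by (simp only: h[symmetric] expect_apply[symmetric] expect_cmult[OF f])
  finally show ?thesis using B(1) by (simp add: zero_le_divide_iff)
qed

lemma expect_mono:
  assumes "f \<in> bcontfun" "g \<in> bcontfun" "\<And>x. f x \<le> g x"
  shows "expect m f \<le> expect m g"
  using expect_nonneg[OF minus_cont[OF assms(2,1)]] assms by (simp add: expect_diff)

lemma abs_expect_le:
  assumes "f \<in> bcontfun"
  shows "\<bar>expect m f\<bar> \<le> expect m (\<lambda>x. \<bar>f x\<bar>)"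
  using expect_mono[OF assms bcontfun_abs[OF assms] abs_ge_self]
    expect_mono[OF uminus_cont[OF assms] bcontfun_abs[OF assms] abs_ge_minus_self]
    expect_cmult[OF assms, of "-1"] by simp

lemma expect_square_ge:
  assumes "f \<in> bcontfun"
  shows "expect m (\<lambda>x. (f x)\<^sup>2) \<ge> 2 * c * expect m f - c\<^sup>2"
proof -
  have "0 \<le> expect m (\<lambda>x. (f x - c)\<^sup>2)"
    by (intro expect_nonneg bcontfun_intros assms) simp
  also have "(\<lambda>x. (f x - c)\<^sup>2) = (\<lambda>x. (f x)\<^sup>2 - (2 * c * f x - c\<^sup>2))"
    by (auto simp: power2_eq_square algebra_simps)
  also have "expect m \<dots> = expect m (\<lambda>x. (f x)\<^sup>2) - (2 * c * expect m f - c\<^sup>2)"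
    by (simp add: expect_diff expect_cmult bcontfun_intros assms)
  finally show ?thesis by simp
qed

lemma expect_square_le:
  assumes "f \<in> bcontfun"
  shows "(expect m f)\<^sup>2 \<le> expect m (\<lambda>x. (f x)\<^sup>2)"
  using expect_square_ge[OF assms, of "expect m f"] by (simp add: power2_eq_square)

end
end

section \<open>Invariant means and their weak* compactness\<close>

lemma expect_shift:
  assumes "m \<in> invariant_means" "f \<in> bcontfun"
  shows "expect m (\<lambda>x. f (x - \<gamma>)) = expect m f"
proof -
  obtain f' where f': "f = apply_bcontfun f'" using assms by (metis bcontfunE)
  have "expect m (\<lambda>x. f (x - \<gamma>)) = m (translate \<gamma> f')"
    unfolding f' by (simp only: translate.rep_eq[symmetric] expect_apply)
  then show ?thesis using assms f' by (simp add: invariant_means_def)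
qed

lemma invariant_means_is_mean: "m \<in> invariant_means \<Longrightarrow> is_mean m"
  by (simp add: invariant_means_def)

text \<open>Continuity is automatic by \<open>linear_mean_bounded\<close>, so an invariant mean can
  be built from a functional known only pointwise, such as a limit of functionals.\<close>

lemma invariant_meansI:
  assumes lin: "linear \<phi>" and one: "\<phi> (ind_fun UNIV) = 1"
    and pos: "\<And>f. (\<And>x. apply_bcontfun f x \<in> {0..1}) \<Longrightarrow> 0 \<le> \<phi> f"
    and inv: "\<And>\<gamma> f. \<phi> (translate \<gamma> f) = \<phi> f"
  shows "Blinfun \<phi> \<in> invariant_means" "blinfun_apply (Blinfun \<phi>) = \<phi>"
proof -
  show *: "blinfun_apply (Blinfun \<phi>) = \<phi>"
    by (rule bounded_linear_Blinfun_apply[OF linear_mean_bounded[OF lin one pos]])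
  show "Blinfun \<phi> \<in> invariant_means"
    using assms by (auto simp: invariant_means_def is_mean_def *)
qed

text \<open>The argument of Banach and Alaoglu: the means lie in the product of the intervals from
  \<open>- norm f\<close> to \<open>norm f\<close>, compact by Tychonoff, and are cut out by closed
  conditions, each of which involves finitely many coordinates.\<close>

lemma compact_invariant_means:
  "compact (blinfun_apply ` (invariant_means :: (('a::{ab_group_add,discrete_topology} \<Rightarrow>\<^sub>C real) \<Rightarrow>\<^sub>L real) set))"
proof -
  let ?I = "invariant_means :: (('a \<Rightarrow>\<^sub>C real) \<Rightarrow>\<^sub>L real) set"
  let ?Z = "{\<phi> :: ('a \<Rightarrow>\<^sub>C real) \<Rightarrow> real. (\<forall>f g. \<phi> (f + g) = \<phi> f + \<phi> g) \<and> (\<forall>c f. \<phi> (c *\<^sub>R f) = c * \<phi> f) \<and>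
      \<phi> (ind_fun UNIV) = 1 \<and> (\<forall>f. (\<forall>x. apply_bcontfun f x \<in> {0..1}) \<longrightarrow> 0 \<le> \<phi> f) \<and>
      (\<forall>\<gamma> f. \<phi> (translate \<gamma> f) = \<phi> f)}"
  have eq: "blinfun_apply ` ?I = ?Z"
  proof (intro equalityI subsetI)
    fix \<phi> assume "\<phi> \<in> blinfun_apply ` ?I"
    then show "\<phi> \<in> ?Z"
      by (auto simp: invariant_means_def is_mean_def blinfun.add_right blinfun.scaleR_right)
  next
    fix \<phi> assume "\<phi> \<in> ?Z"
    then have "Blinfun \<phi> \<in> ?I" "blinfun_apply (Blinfun \<phi>) = \<phi>"
      by (auto intro!: invariant_meansI linearI)
    then show "\<phi> \<in> blinfun_apply ` ?I" by (metis imageI)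
  qed
  let ?P = "PiE UNIV (\<lambda>f::'a \<Rightarrow>\<^sub>C real. {- norm f..norm f})"
  have "compactin (product_topology (\<lambda>i. euclidean) UNIV) ?P"
    by (simp add: compactin_PiE)
  then have cpt: "compact ?P" by (simp add: euclidean_product_topology)
  have sub: "blinfun_apply ` ?I \<subseteq> ?P"
  proof -
    have "\<bar>blinfun_apply m f\<bar> \<le> norm f" if "m \<in> ?I" for m f
    proof -
      have m: "is_mean m" using that by (rule invariant_means_is_mean)
      have "\<bar>expect m (apply_bcontfun f)\<bar> \<le> expect m (\<lambda>x. \<bar>apply_bcontfun f x\<bar>)"
        by (intro abs_expect_le m bcontfun_intros)
      also have "\<dots> \<le> expect m (\<lambda>x. norm f)"
        using norm_bounded[of f] by (intro expect_mono m bcontfun_intros) simp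
      finally show ?thesis by (simp add: m)
    qed
    then show ?thesis by (auto simp: abs_le_iff minus_le_iff)
  qed
  have coord: "continuous_on UNIV (\<lambda>\<phi> :: ('a \<Rightarrow>\<^sub>C real) \<Rightarrow> real. \<phi> f)" for f
    by (rule continuous_on_product_coordinates)
  have "closed {\<phi> :: ('a \<Rightarrow>\<^sub>C real) \<Rightarrow> real. \<forall>f g. \<phi> (f + g) = \<phi> f + \<phi> g}"
    "closed {\<phi> :: ('a \<Rightarrow>\<^sub>C real) \<Rightarrow> real. \<forall>c f. \<phi> (c *\<^sub>R f) = c * \<phi> f}"
    "closed {\<phi> :: ('a \<Rightarrow>\<^sub>C real) \<Rightarrow> real. \<forall>\<gamma> f. \<phi> (translate \<gamma> f) = \<phi> f}"
    by (intro closed_Collect_all closed_Collect_eq continuous_on_add continuous_on_mult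
        continuous_on_const coord)+
  moreover have "closed {\<phi> :: ('a \<Rightarrow>\<^sub>C real) \<Rightarrow> real. \<phi> (ind_fun UNIV) = 1}"
    by (intro closed_Collect_eq continuous_on_const coord)
  moreover have "closed {\<phi> :: ('a \<Rightarrow>\<^sub>C real) \<Rightarrow> real. \<forall>f. (\<forall>x. apply_bcontfun f x \<in> {0..1}) \<longrightarrow> 0 \<le> \<phi> f}"
    by (intro closed_Collect_all closed_Collect_imp open_Collect_const closed_Collect_le
        continuous_on_const coord)
  ultimately have "closed ?Z" by (intro closed_Collect_conj)
  then show ?thesis
    using compact_Int_closed[OF cpt, of ?Z] sub unfolding eq by (simp add: Int_absorb1)
qed

lemma expect_nonneg_of_extreme:
  assumes m: "m \<in> invariant_means" and g: "g \<in> bcontfun"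
    and ext: "\<And>\<nu>. \<nu> extreme_point_of invariant_means \<Longrightarrow> 0 \<le> expect \<nu> g"
  shows "0 \<le> expect m g"
proof -
  obtain e where "e extreme_point_of invariant_means"
    "\<And>x. x \<in> invariant_means \<Longrightarrow> blinfun_apply e (Bcontfun g) \<le> blinfun_apply x (Bcontfun g)"
    using extreme_point_minimizing[OF compact_invariant_means] m by blast
  then show ?thesis using ext m unfolding expect_def by fastforce
qed

subsection \<open>Limits of densities\<close>

lemma expect_abs_triangle:
  assumes "is_mean m" "f \<in> bcontfun" "g \<in> bcontfun" "h \<in> bcontfun"
  shows "expect m (\<lambda>x. \<bar>f x - h x\<bar>) \<le> expect m (\<lambda>x. \<bar>f x - g x\<bar>) + expect m (\<lambda>x. \<bar>g x - h x\<bar>)"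
proof -
  have "expect m (\<lambda>x. \<bar>f x - h x\<bar>) \<le> expect m (\<lambda>x. \<bar>f x - g x\<bar> + \<bar>g x - h x\<bar>)"
    by (intro expect_mono assms(1) bcontfun_intros assms(2-4)) linarith
  then show ?thesis by (simp add: expect_add bcontfun_intros assms)
qed

lemma expect_mult_diff_le:
  assumes m: "is_mean m" and "g \<in> bcontfun" "h \<in> bcontfun" "h' \<in> bcontfun"
    and B: "\<And>x. \<bar>g x\<bar> \<le> B"
  shows "\<bar>expect m (\<lambda>x. g x * h x) - expect m (\<lambda>x. g x * h' x)\<bar> \<le> B * expect m (\<lambda>x. \<bar>h x - h' x\<bar>)"
proof -
  have "expect m (\<lambda>x. g x * h x) - expect m (\<lambda>x. g x * h' x) = expect m (\<lambda>x. g x * h x - g x * h' x)"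
    by (intro expect_diff[symmetric] bcontfun_intros assms)
  also have "\<bar>\<dots>\<bar> \<le> expect m (\<lambda>x. \<bar>g x * h x - g x * h' x\<bar>)"
    by (intro abs_expect_le m bcontfun_intros assms)
  also have "\<dots> \<le> expect m (\<lambda>x. B * \<bar>h x - h' x\<bar>)"
    by (intro expect_mono m bcontfun_intros assms)
       (simp add: right_diff_distrib[symmetric] abs_mult mult_right_mono B)
  also have "\<dots> = B * expect m (\<lambda>x. \<bar>h x - h' x\<bar>)"
    by (intro expect_cmult bcontfun_intros assms)
  finally show ?thesis .
qed

lemma expect_lipschitz_le:
  assumes m: "is_mean m" and "f \<in> bcontfun" "g \<in> bcontfun"
    and "(\<lambda>x. q (f x)) \<in> bcontfun" "(\<lambda>x. q (g x)) \<in> bcontfun"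
    and lip: "\<And>s t. \<bar>q s - q t\<bar> \<le> L * \<bar>s - t\<bar>"
  shows "expect m (\<lambda>x. \<bar>q (f x) - q (g x)\<bar>) \<le> L * expect m (\<lambda>x. \<bar>f x - g x\<bar>)"
proof -
  have "expect m (\<lambda>x. \<bar>q (f x) - q (g x)\<bar>) \<le> expect m (\<lambda>x. L * \<bar>f x - g x\<bar>)"
    by (intro expect_mono m bcontfun_intros assms(2-5) lip)
  then show ?thesis by (simp add: expect_cmult bcontfun_intros assms)
qed

text \<open>A substitute for the mean ergodic theorem: by the parallelogram law, a sequence minimizing
  the second moment is Cauchy and asymptotically invariant.\<close>

lemma minimizing_sequence:
  fixes S :: "('a::{ab_group_add,discrete_topology} \<Rightarrow> real) set"
  assumes inv: "m \<in> invariant_means" and S: "S \<subseteq> bcontfun" "S \<noteq> {}"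
    and mid: "\<And>f g. f \<in> S \<Longrightarrow> g \<in> S \<Longrightarrow> (\<lambda>x. (f x + g x) / 2) \<in> S"
    and shift: "\<And>f \<gamma>. f \<in> S \<Longrightarrow> (\<lambda>x. f (x - \<gamma>)) \<in> S"
    and \<epsilon>: "\<And>n::nat. 0 < \<epsilon> n" "decseq \<epsilon>"
  obtains f :: "nat \<Rightarrow> 'a \<Rightarrow> real" where "\<And>n. f n \<in> S"
    and "\<And>N n n'. N \<le> n \<Longrightarrow> N \<le> n' \<Longrightarrow> expect m (\<lambda>x. \<bar>f n x - f n' x\<bar>) \<le> \<epsilon> N"
    and "\<And>n \<gamma>. expect m (\<lambda>x. \<bar>f n x - f n (x - \<gamma>)\<bar>) \<le> \<epsilon> n"
proof -
  have m: "is_mean m" by (rule invariant_means_is_mean[OF inv])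
  define V where "V f = expect m (\<lambda>x. (f x)\<^sup>2)" for f
  define \<alpha> where "\<alpha> = Inf (V ` S)"
  have bcf: "f \<in> bcontfun" if "f \<in> S" for f using S that by blast
  have V0: "0 \<le> V f" if "f \<in> S" for f
    unfolding V_def by (intro expect_nonneg m bcontfun_intros bcf that) simp
  have bdd: "bdd_below (V ` S)" using V0 by (intro bdd_belowI[of _ 0]) auto
  have \<alpha>: "\<alpha> \<le> V f" if "f \<in> S" for f
    unfolding \<alpha>_def using bdd that by (simp add: cINF_lower)
  \<comment> \<open>Two near-minimizers are close. The identity is |f - g|^2 = 2 f^2 + 2 g^2 - 4 ((f
    + g)/2)^2; the midpoint lies in \<open>S\<close>, so its second moment is at least
    \<open>\<alpha>\<close>, and the two excesses of (e/2)^2 add up to e^2. Jensen passes from the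
    second moment of f - g to its L^1 size.\<close>
  have close: "expect m (\<lambda>x. \<bar>f x - g x\<bar>) \<le> e"
    if f: "f \<in> S" "V f \<le> \<alpha> + (e/2)\<^sup>2" and g: "g \<in> S" "V g \<le> \<alpha> + (e/2)\<^sup>2" and e: "0 < e" for f g e
  proof (rule power2_le_imp_le)
    note bf = bcf[OF f(1)] and bg = bcf[OF g(1)]
    have "(expect m (\<lambda>x. \<bar>f x - g x\<bar>))\<^sup>2 \<le> expect m (\<lambda>x. \<bar>f x - g x\<bar>\<^sup>2)"
      by (intro expect_square_le m bcontfun_intros bf bg)
    also have "(\<lambda>x. \<bar>f x - g x\<bar>\<^sup>2) = (\<lambda>x. (2 * (f x)\<^sup>2 + 2 * (g x)\<^sup>2) - 4 * ((f x + g x) / 2)\<^sup>2)"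
      by (auto simp: power2_eq_square field_simps)
    also have "expect m \<dots> = 2 * V f + 2 * V g - 4 * V (\<lambda>x. (f x + g x) / 2)"
    proof -
      have h: "(\<lambda>x. (f x + g x) / 2) \<in> bcontfun" by (intro bcf mid f g)
      then have h2: "(\<lambda>x. ((f x + g x) / 2)\<^sup>2) \<in> bcontfun" by (rule bcontfun_power)
      have f2: "(\<lambda>x. (f x)\<^sup>2) \<in> bcontfun" and g2: "(\<lambda>x. (g x)\<^sup>2) \<in> bcontfun"
        by (intro bcontfun_power bf bg)+
      have "expect m (\<lambda>x. (2 * (f x)\<^sup>2 + 2 * (g x)\<^sup>2) - 4 * ((f x + g x) / 2)\<^sup>2)
          = expect m (\<lambda>x. 2 * (f x)\<^sup>2 + 2 * (g x)\<^sup>2) - expect m (\<lambda>x. 4 * ((f x + g x) / 2)\<^sup>2)"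
        by (rule expect_diff) (intro bcontfun_mult plus_cont const_bcontfun f2 g2 h2)+
      also have "expect m (\<lambda>x. 2 * (f x)\<^sup>2 + 2 * (g x)\<^sup>2) = expect m (\<lambda>x. 2 * (f x)\<^sup>2) + expect m (\<lambda>x. 2 * (g x)\<^sup>2)"
        by (rule expect_add) (intro bcontfun_mult const_bcontfun f2 g2)+
      finally show ?thesis unfolding V_def
        by (simp only: expect_cmult[OF f2] expect_cmult[OF g2] expect_cmult[OF h2])
    qed
    also have "\<dots> \<le> e\<^sup>2"
    proof -
      have "\<alpha> \<le> V (\<lambda>x. (f x + g x) / 2)" by (intro \<alpha> mid f g)
      with f(2) g(2) show ?thesis by (simp add: power_divide)
    qed
    finally show "(expect m (\<lambda>x. \<bar>f x - g x\<bar>))\<^sup>2 \<le> e\<^sup>2" .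
  qed (use e in simp)
  have "\<exists>f\<in>S. V f < \<alpha> + (\<epsilon> n / 2)\<^sup>2" for n
  proof -
    have "\<alpha> < \<alpha> + (\<epsilon> n / 2)\<^sup>2" using \<epsilon>(1)[of n] by simp
    then show ?thesis using cINF_less_iff[of S V "\<alpha> + (\<epsilon> n / 2)\<^sup>2"] S(2) bdd unfolding \<alpha>_def by blast
  qed
  then obtain f where f: "\<And>n. f n \<in> S" "\<And>n. V (f n) < \<alpha> + (\<epsilon> n / 2)\<^sup>2" by metis
  have le: "V (f n) \<le> \<alpha> + (\<epsilon> N / 2)\<^sup>2" if "N \<le> n" for N n
  proof -
    have "(\<epsilon> n / 2)\<^sup>2 \<le> (\<epsilon> N / 2)\<^sup>2"
      using decseqD[OF \<epsilon>(2) that] \<epsilon>(1)[of n] by (intro power_mono) auto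
    then show ?thesis using f(2)[of n] by simp
  qed
  show thesis
  proof (rule that[of f])
    show "expect m (\<lambda>x. \<bar>f n x - f n' x\<bar>) \<le> \<epsilon> N" if "N \<le> n" "N \<le> n'" for N n n'
      by (intro close f le that \<epsilon>)
    \<comment> \<open>A translate of \<open>f n\<close> has the same second moment and stays in
      \<open>S\<close>, so it is a near-minimizer too, and \<open>close\<close> applies to the
      pair.\<close>
    show "expect m (\<lambda>x. \<bar>f n x - f n (x - \<gamma>)\<bar>) \<le> \<epsilon> n" for n \<gamma>
    proof (rule close)
      have "V (\<lambda>x. f n (x - \<gamma>)) = V (f n)"
        unfolding V_def using expect_shift[OF inv bcontfun_power[OF bcf[OF f(1)[of n]]], where \<gamma>=\<gamma>] .
      then show "V (\<lambda>x. f n (x - \<gamma>)) \<le> \<alpha> + (\<epsilon> n / 2)\<^sup>2" using le[of n n] by simp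
    qed (use f le \<epsilon> shift in auto)
  qed (rule f)
qed

text \<open>The functionals g \<mapsto> m(g h_n) converge because h_n is Cauchy in L^1(m), and
  dividing the limit by its total mass c gives a mean. This realizes the restriction of m to a limit
  density without exhibiting that density as a function.\<close>

lemma density_limit:
  fixes h :: "nat \<Rightarrow> 'a::{ab_group_add,discrete_topology} \<Rightarrow> real"
  assumes inv: "m \<in> invariant_means"
    and h01: "\<And>n x. 0 \<le> h n x" "\<And>n x. h n x \<le> 1"
    and cau: "\<And>e. 0 < e \<Longrightarrow> \<exists>N. \<forall>n\<ge>N. \<forall>n'\<ge>N. expect m (\<lambda>x. \<bar>h n x - h n' x\<bar>) < e"
    and shift: "\<And>\<gamma>. (\<lambda>n. expect m (\<lambda>x. \<bar>h n x - h n (x - \<gamma>)\<bar>)) \<longlonglongrightarrow> 0"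
  obtains c \<nu> where "\<nu> \<in> invariant_means" "0 \<le> c" "(\<lambda>n. expect m (h n)) \<longlonglongrightarrow> c"
    and "\<And>g. g \<in> bcontfun \<Longrightarrow> (\<lambda>n. expect m (\<lambda>x. g x * h n x)) \<longlonglongrightarrow> c * expect \<nu> g"
proof -
  have m: "is_mean m" by (rule invariant_means_is_mean[OF inv])
  have bh: "h n \<in> bcontfun" for n
    using h01 by (intro bcontfun_discreteI[of _ 1]) simp
  have conv: "convergent (\<lambda>n. expect m (\<lambda>x. g x * h n x))" if g: "g \<in> bcontfun" for g
  proof -
    obtain B where B: "0 \<le> B" "\<And>x. \<bar>g x\<bar> \<le> B" using bcontfun_discreteE[OF g] by blast
    have "Cauchy (\<lambda>n. expect m (\<lambda>x. g x * h n x))"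
    proof (rule metric_CauchyI)
      fix e :: real assume e: "0 < e"
      then obtain N where N: "\<forall>n\<ge>N. \<forall>n'\<ge>N. expect m (\<lambda>x. \<bar>h n x - h n' x\<bar>) < e / (B + 1)"
        using cau[of "e / (B + 1)"] B by auto
      have "dist (expect m (\<lambda>x. g x * h n x)) (expect m (\<lambda>x. g x * h n' x)) < e" if "n \<ge> N" "n' \<ge> N" for n n'
      proof -
        have "\<bar>expect m (\<lambda>x. g x * h n x) - expect m (\<lambda>x. g x * h n' x)\<bar>
            \<le> B * expect m (\<lambda>x. \<bar>h n x - h n' x\<bar>)"
          by (intro expect_mult_diff_le m g bh B)
        also have "\<dots> \<le> B * (e / (B + 1))"
          using N that B(1) by (intro mult_left_mono) (auto intro: less_imp_le)
        also have "\<dots> < e" using B(1) e by (simp add: field_simps)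
        finally show ?thesis by (simp add: dist_real_def)
      qed
      then show "\<exists>N. \<forall>n\<ge>N. \<forall>n'\<ge>N. dist (expect m (\<lambda>x. g x * h n x)) (expect m (\<lambda>x. g x * h n' x)) < e"
        by blast
    qed
    then show ?thesis by (rule Cauchy_convergent)
  qed
  define J where "J g = lim (\<lambda>n. expect m (\<lambda>x. g x * h n x))" for g
  have J: "(\<lambda>n. expect m (\<lambda>x. g x * h n x)) \<longlonglongrightarrow> J g" if "g \<in> bcontfun" for g
    using conv[OF that] unfolding J_def convergent_LIMSEQ_iff .
  define c where "c = J (\<lambda>x. 1)"
  have c: "(\<lambda>n. expect m (h n)) \<longlonglongrightarrow> c"
    using J[OF const_bcontfun[of 1]] by (simp add: c_def)
  have "0 \<le> c"
    by (rule LIMSEQ_le_const[OF c]) (auto intro!: expect_nonneg m bh h01)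
  show thesis
  proof (cases "c = 0")
    case True
    \<comment> \<open>For total mass 0 nothing can be normalized, but both sides of the claim
      vanish, so \<open>m\<close> serves as a default for \<open>\<nu>\<close>.\<close>
    have "(\<lambda>n. expect m (\<lambda>x. g x * h n x)) \<longlonglongrightarrow> c * expect m g" if g: "g \<in> bcontfun" for g
    proof -
      obtain B where B: "0 \<le> B" "\<And>x. \<bar>g x\<bar> \<le> B" using bcontfun_discreteE[OF g] by blast
      have "(\<lambda>n. expect m (\<lambda>x. g x * h n x)) \<longlonglongrightarrow> 0"
      proof (rule Lim_null_comparison)
        have "norm (expect m (\<lambda>x. g x * h n x)) \<le> B * expect m (h n)" for n
          using expect_mult_diff_le[OF m g bh[of n] const_bcontfun[of 0] B(2)] m
          by (simp add: h01)
        then show "\<forall>\<^sub>F n in sequentially. norm (expect m (\<lambda>x. g x * h n x)) \<le> B * expect m (h n)"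
          by simp
        show "(\<lambda>n. B * expect m (h n)) \<longlonglongrightarrow> 0"
          using tendsto_mult_left[OF c, of B] True by simp
      qed
      with True show ?thesis by simp
    qed
    with c \<open>0 \<le> c\<close> inv show thesis using that by blast
  next
    case False
    with \<open>0 \<le> c\<close> have cpos: "0 < c" by simp
    define \<phi> where "\<phi> f = J (apply_bcontfun f) / c" for f
    have eqI: "J g = l" if "g \<in> bcontfun" "(\<lambda>n. expect m (\<lambda>x. g x * h n x)) \<longlonglongrightarrow> l" for g l
      using LIMSEQ_unique[OF J[OF that(1)] that(2)] .
    have lin: "linear \<phi>"
    proof (rule linearI)
      fix f g :: "'a \<Rightarrow>\<^sub>C real" and r :: real
      have "J (apply_bcontfun (f + g)) = J (apply_bcontfun f) + J (apply_bcontfun g)"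
        by (rule eqI, rule apply_bcontfun)
           (use tendsto_add[OF J[OF apply_bcontfun[of f]] J[OF apply_bcontfun[of g]]] in
             \<open>simp add: distrib_right expect_add bcontfun_mult apply_bcontfun bh\<close>)
      then show "\<phi> (f + g) = \<phi> f + \<phi> g" by (simp add: \<phi>_def add_divide_distrib)
      have "J (apply_bcontfun (r *\<^sub>R f)) = r * J (apply_bcontfun f)"
        by (rule eqI, rule apply_bcontfun)
           (use tendsto_mult_left[OF J[OF apply_bcontfun[of f]], of r] in
             \<open>simp add: mult.assoc expect_cmult bcontfun_mult apply_bcontfun bh\<close>)
      then show "\<phi> (r *\<^sub>R f) = r *\<^sub>R \<phi> f" by (simp add: \<phi>_def)
    qed
    have one: "\<phi> (ind_fun UNIV) = 1"
      using cpos by (simp add: \<phi>_def ind_fun.rep_eq c_def)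
    have pos: "0 \<le> \<phi> f" if "\<And>x. apply_bcontfun f x \<in> {0..1}" for f
    proof -
      have "0 \<le> J (apply_bcontfun f)"
        by (rule LIMSEQ_le_const[OF J[OF apply_bcontfun]])
           (use that in \<open>auto intro!: exI[of _ 0] expect_nonneg m bcontfun_mult apply_bcontfun bh h01 mult_nonneg_nonneg\<close>)
      then show ?thesis using cpos by (simp add: \<phi>_def)
    qed
    have tr: "\<phi> (translate \<gamma> f) = \<phi> f" for \<gamma> f
    proof -
      let ?f = "apply_bcontfun f"
      obtain B where B: "0 \<le> B" "\<And>x. \<bar>?f x\<bar> \<le> B"
        using bcontfun_discreteE[OF apply_bcontfun[of f]] by blast
      have bs: "(\<lambda>x. ?f (x - \<gamma>)) \<in> bcontfun" by (rule bcontfun_shift[OF apply_bcontfun])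
      have bhs: "(\<lambda>x. h n (x - \<gamma>)) \<in> bcontfun" for n by (rule bcontfun_shift[OF bh])
      \<comment> \<open>By invariance of \<open>m\<close>, the second term may be translated as a
        whole. The two terms then differ only in the density factor, whose translation costs an
        amount tending to 0.\<close>
      have "(\<lambda>n. expect m (\<lambda>x. ?f (x - \<gamma>) * h n x) - expect m (\<lambda>x. ?f x * h n x)) \<longlonglongrightarrow> 0"
      proof (rule Lim_null_comparison)
        have "norm (expect m (\<lambda>x. ?f (x - \<gamma>) * h n x) - expect m (\<lambda>x. ?f x * h n x))
            \<le> B * expect m (\<lambda>x. \<bar>h n x - h n (x - \<gamma>)\<bar>)" for n
          using expect_mult_diff_le[OF m bs bh[of n] bhs[of n] B(2)]
            expect_shift[OF inv bcontfun_mult[OF apply_bcontfun[of f] bh[of n]], of \<gamma>] by simp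
        then show "\<forall>\<^sub>F n in sequentially. norm (expect m (\<lambda>x. ?f (x - \<gamma>) * h n x) - expect m (\<lambda>x. ?f x * h n x))
            \<le> B * expect m (\<lambda>x. \<bar>h n x - h n (x - \<gamma>)\<bar>)" by simp
        show "(\<lambda>n. B * expect m (\<lambda>x. \<bar>h n x - h n (x - \<gamma>)\<bar>)) \<longlonglongrightarrow> 0"
          using tendsto_mult_left[OF shift, of B \<gamma>] by simp
      qed
      from tendsto_add[OF this J[OF apply_bcontfun[of f]]]
      have "J (\<lambda>x. ?f (x - \<gamma>)) = J ?f" by (intro eqI bs) simp
      then show ?thesis by (simp add: \<phi>_def translate.rep_eq)
    qed
    have \<nu>: "Blinfun \<phi> \<in> invariant_means" "blinfun_apply (Blinfun \<phi>) = \<phi>"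
      by (rule invariant_meansI[OF lin one]; simp add: pos tr)+
    have "c * expect (Blinfun \<phi>) g = J g" if "g \<in> bcontfun" for g
      using cpos that by (simp add: expect_def \<nu>(2) \<phi>_def Bcontfun_inverse)
    then show thesis using that[OF \<nu>(1) \<open>0 \<le> c\<close> c] J by simp
  qed
qed

text \<open>The inequality is linear in the mean, so extreme \<nu> suffice. If \<nu>(F) > 0, then
  \<nu>(G) = 0 and the left side vanishes. Otherwise \<nu>(f) = \<nu>(F) \<le> 0, and Jensen gives
  \<nu>((f - c)^2) \<ge> (c - \<nu>(F))^2 \<ge> c^2 \<ge> c^2 \<nu>(G).\<close>

lemma square_deviation_ge:
  assumes m: "m \<in> invariant_means" and b: "F \<in> bcontfun" "G \<in> bcontfun" "f \<in> bcontfun"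
    and G: "\<And>x. G x \<le> 1" and c: "0 < c"
    and ext: "\<And>\<nu>. \<nu> extreme_point_of invariant_means \<Longrightarrow> 0 < expect \<nu> F \<Longrightarrow> expect \<nu> G = 0"
    and f: "\<And>\<nu>. \<nu> \<in> invariant_means \<Longrightarrow> expect \<nu> f = expect \<nu> F"
  shows "c\<^sup>2 * expect m G \<le> expect m (\<lambda>x. (f x - c)\<^sup>2)"
proof -
  have bf: "(\<lambda>x. f x - c) \<in> bcontfun" by (intro bcontfun_intros b)
  have bsq: "(\<lambda>x. (f x - c)\<^sup>2) \<in> bcontfun" by (rule bcontfun_power[OF bf])
  have bcG: "(\<lambda>x. c\<^sup>2 * G x) \<in> bcontfun" by (intro bcontfun_mult const_bcontfun b)
  have split: "expect \<nu> (\<lambda>x. (f x - c)\<^sup>2 - c\<^sup>2 * G x) = expect \<nu> (\<lambda>x. (f x - c)\<^sup>2) - c\<^sup>2 * expect \<nu> G" for \<nu>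
    by (simp only: expect_diff[OF bsq bcG] expect_cmult[OF b(2)])
  have "0 \<le> expect m (\<lambda>x. (f x - c)\<^sup>2 - c\<^sup>2 * G x)"
  proof (rule expect_nonneg_of_extreme[OF m minus_cont[OF bsq bcG]])
    fix \<nu> :: "('a \<Rightarrow>\<^sub>C real) \<Rightarrow>\<^sub>L real" assume \<nu>: "\<nu> extreme_point_of invariant_means"
    then have inv: "\<nu> \<in> invariant_means" by (simp add: extreme_point_of_def)
    note mean = invariant_means_is_mean[OF inv]
    define \<phi> where "\<phi> = expect \<nu> F"
    have "expect \<nu> (\<lambda>x. f x - c) = \<phi> - c"
      using expect_diff[OF b(3) const_bcontfun[of c], of \<nu>] f[OF inv] mean by (simp add: \<phi>_def)
    then have sq: "(\<phi> - c)\<^sup>2 \<le> expect \<nu> (\<lambda>x. (f x - c)\<^sup>2)"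
      using expect_square_le[OF mean bf] by simp
    have "c\<^sup>2 * expect \<nu> G \<le> (\<phi> - c)\<^sup>2"
    proof (cases "0 < \<phi>")
      case True
      then show ?thesis using ext[OF \<nu>] by (simp add: \<phi>_def)
    next
      case False
      have "expect \<nu> G \<le> 1"
        using expect_mono[OF mean b(2) const_bcontfun[of 1]] G mean by simp
      then have "c\<^sup>2 * expect \<nu> G \<le> c\<^sup>2" by (simp add: mult_left_le)
      also have "\<dots> \<le> (c - \<phi>)\<^sup>2" using False c by (intro power_mono) auto
      finally show ?thesis by (simp add: power2_commute)
    qed
    with sq show "0 \<le> expect \<nu> (\<lambda>x. (f x - c)\<^sup>2 - c\<^sup>2 * G x)" unfolding split by simp
  qed
  then show ?thesis unfolding split by simp
qed

subsection \<open>Slices by level\<close>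

text \<open>A Lipschitz stand-in for an indicator of a half-line: rescaled and shifted, it cuts the
  range of f_n without destroying L^1 estimates.\<close>

definition ramp :: "real \<Rightarrow> real" where
  "ramp s = min 1 (max 0 s)"

lemma ramp_bounds: "0 \<le> ramp s" "ramp s \<le> 1"
  by (auto simp: ramp_def)

lemma ramp_mono: "s \<le> t \<Longrightarrow> ramp s \<le> ramp t"
  by (auto simp: ramp_def)

lemma ramp_lipschitz: "\<bar>ramp s - ramp t\<bar> \<le> \<bar>s - t\<bar>"
  by (auto simp: ramp_def)

lemma ramp_diff_le: "ramp s - ramp t \<le> 1"
  using ramp_bounds(2)[of s] ramp_bounds(1)[of t] by linarith

lemma bcontfun_ramp: "(\<lambda>x. ramp (f x)) \<in> bcontfun"
  for f :: "'a::discrete_topology \<Rightarrow> real"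
  by (rule bcontfun_discreteI[of _ 1]) (simp add: ramp_def)

text \<open>The sequence \<open>f\<close> plays the role of \<open>P F\<close>. The assumption
  \<open>avg\<close> covers all invariant means, not just \<open>m\<close>, because the square
  inequality is applied to restrictions of \<open>m\<close>. The rate in \<open>\<epsilon>1\<close>
  is what allows cutting at the thresholds 1/(n+1).\<close>

locale averaging_sequence =
  fixes m :: "('a::{ab_group_add,discrete_topology} \<Rightarrow>\<^sub>C real) \<Rightarrow>\<^sub>L real"
    and F G :: "'a \<Rightarrow> real" and f :: "nat \<Rightarrow> 'a \<Rightarrow> real" and \<epsilon> :: "nat \<Rightarrow> real"
  assumes inv: "m \<in> invariant_means"
    and bF: "F \<in> bcontfun" and bG: "G \<in> bcontfun"
    and G01: "\<And>x. 0 \<le> G x" "\<And>x. G x \<le> 1"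
    and ext: "\<And>\<nu>. \<nu> extreme_point_of invariant_means \<Longrightarrow> 0 < expect \<nu> F \<Longrightarrow> expect \<nu> G = 0"
    and f2: "\<And>n x. \<bar>f n x\<bar> \<le> 2"
    and avg: "\<And>n \<nu>. \<nu> \<in> invariant_means \<Longrightarrow> expect \<nu> (f n) = expect \<nu> F"
    and cauchy: "\<And>N n n'. N \<le> n \<Longrightarrow> N \<le> n' \<Longrightarrow> expect m (\<lambda>x. \<bar>f n x - f n' x\<bar>) \<le> \<epsilon> N"
    and almost_inv: "\<And>n \<gamma>. expect m (\<lambda>x. \<bar>f n x - f n (x - \<gamma>)\<bar>) \<le> \<epsilon> n"
    and \<epsilon>0: "\<epsilon> \<longlonglongrightarrow> 0" and \<epsilon>1: "(\<lambda>n. real (n + 1) * \<epsilon> n) \<longlonglongrightarrow> 0"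
begin

lemma m: "is_mean m"
  by (rule invariant_means_is_mean[OF inv])

lemma bf: "f n \<in> bcontfun"
  by (rule bcontfun_discreteI[OF f2])

lemma \<epsilon>_nonneg: "0 \<le> \<epsilon> n"
  using cauchy[of n n n] m by simp

lemma \<epsilon>_small:
  assumes "0 < (e::real)"
  shows "\<exists>N. C * \<epsilon> N < e"
proof -
  have "(\<lambda>n. C * \<epsilon> n) \<longlonglongrightarrow> 0" using tendsto_mult_left[OF \<epsilon>0, of C] by simp
  from order_tendstoD(2)[OF this assms] show ?thesis
    by (auto simp: eventually_sequentially)
qed

section \<open>Restrictions of m whose densities are Lipschitz functions of the averages\<close>

context
  fixes q :: "real \<Rightarrow> real" and L :: real
  assumes q01: "\<And>s. 0 \<le> q s" "\<And>s. q s \<le> 1"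
    and qL: "\<And>s t. \<bar>q s - q t\<bar> \<le> L * \<bar>s - t\<bar>"
begin

lemma bcontfun_weight: "(\<lambda>x. q (g x)) \<in> bcontfun" for g :: "'a \<Rightarrow> real"
  using q01 by (intro bcontfun_discreteI[of _ 1]) simp

lemma lipschitz_nonneg: "0 \<le> L"
  using qL[of 0 1] abs_ge_zero[of "q 0 - q 1"] by simp

lemma weight_cauchy:
  assumes "N \<le> n" "N \<le> n'"
  shows "expect m (\<lambda>x. \<bar>q (f n x) - q (f n' x)\<bar>) \<le> L * \<epsilon> N"
  using expect_lipschitz_le[of m "f n" "f n'" q L, OF m bf bf bcontfun_weight bcontfun_weight qL]
    mult_left_mono[OF cauchy[OF assms] lipschitz_nonneg] by linarith

lemma weight_almost_inv:
  "expect m (\<lambda>x. \<bar>q (f n x) - q (f n (x - \<gamma>))\<bar>) \<le> L * \<epsilon> n"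
  using expect_lipschitz_le[OF m bf bcontfun_shift[OF bf] bcontfun_weight bcontfun_weight qL, of n n \<gamma>]
    mult_left_mono[OF almost_inv lipschitz_nonneg, of n \<gamma>] by linarith

text \<open>A Lipschitz \<open>q\<close> transfers the Cauchy property and the asymptotic invariance
  from f_n to q(f_n), so \<open>density_limit\<close> provides the restriction of m with density q(P
  F).\<close>

lemma weight_limit:
  obtains c \<nu> where "\<nu> \<in> invariant_means" "0 \<le> c" "(\<lambda>n. expect m (\<lambda>x. q (f n x))) \<longlonglongrightarrow> c"
    and "\<And>g. g \<in> bcontfun \<Longrightarrow> (\<lambda>n. expect m (\<lambda>x. g x * q (f n x))) \<longlonglongrightarrow> c * expect \<nu> g"
proof (rule density_limit[OF inv, of "\<lambda>n x. q (f n x)"])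
  show "\<exists>N. \<forall>n\<ge>N. \<forall>n'\<ge>N. expect m (\<lambda>x. \<bar>q (f n x) - q (f n' x)\<bar>) < e" if "0 < e" for e
    using \<epsilon>_small[OF that, of L] weight_cauchy by (meson le_less_trans)
  show "(\<lambda>n. expect m (\<lambda>x. \<bar>q (f n x) - q (f n (x - \<gamma>))\<bar>)) \<longlonglongrightarrow> 0" for \<gamma>
  proof (rule Lim_null_comparison)
    show "\<forall>\<^sub>F n in sequentially. norm (expect m (\<lambda>x. \<bar>q (f n x) - q (f n (x - \<gamma>))\<bar>)) \<le> L * \<epsilon> n"
      using weight_almost_inv
      by (intro always_eventually allI) (simp add: abs_of_nonneg expect_nonneg[OF m] bcontfun_abs
          minus_cont bcontfun_weight)
    show "(\<lambda>n. L * \<epsilon> n) \<longlonglongrightarrow> 0" using tendsto_mult_left[OF \<epsilon>0, of L] by simp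
  qed
qed (use q01 that in auto)

text \<open>Let \<nu> be the restriction of m with density q(P F) and total mass \<open>I\<close>,
  so that J = I * \<nu>(G). On this slice P F lies within w of c, so \<nu>((f_k - c)^2) is at most
  w^2 up to an error vanishing with k, while \<open>square_deviation_ge\<close> bounds it below by
  c^2 \<nu>(G).\<close>

lemma slice_bound:
  assumes supp: "\<And>s. q s \<noteq> 0 \<Longrightarrow> c \<le> s \<and> s \<le> c + w" and c: "0 < c"
  obtains J I where "(\<lambda>n. expect m (\<lambda>x. G x * q (f n x))) \<longlonglongrightarrow> J"
    and "(\<lambda>n. expect m (\<lambda>x. q (f n x))) \<longlonglongrightarrow> I" and "c\<^sup>2 * J \<le> w\<^sup>2 * I"
proof -
  obtain I \<nu> where \<nu>: "\<nu> \<in> invariant_means" "0 \<le> I" and I: "(\<lambda>n. expect m (\<lambda>x. q (f n x))) \<longlonglongrightarrow> I"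
    and lim: "\<And>g. g \<in> bcontfun \<Longrightarrow> (\<lambda>n. expect m (\<lambda>x. g x * q (f n x))) \<longlonglongrightarrow> I * expect \<nu> g"
    using weight_limit by blast
  let ?C = "4 + 2 * c"
  have sq: "(\<lambda>x. (f k x - c)\<^sup>2) \<in> bcontfun" for k
    by (intro bcontfun_intros bf)
  \<comment> \<open>Two indices are in play: \<open>f k\<close> is fixed, so that \<open>lim\<close>
    applies to its squared deviation, while the weight uses \<open>f n\<close> with n tending to
    infinity. Replacing \<open>f n\<close> by \<open>f k\<close> in the square costs at most
    \<open>?C * \<epsilon> k\<close>, as \<open>?C\<close> bounds |f k + f n - 2 c|.\<close>
  have main: "c\<^sup>2 * (I * expect \<nu> G) \<le> w\<^sup>2 * I + ?C * \<epsilon> k" for k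
  proof -
    have "c\<^sup>2 * expect \<nu> G \<le> expect \<nu> (\<lambda>x. (f k x - c)\<^sup>2)"
      by (rule square_deviation_ge[OF \<nu>(1) bF bG bf G01(2) c ext avg])
    from mult_left_mono[OF this \<nu>(2)]
    have "c\<^sup>2 * (I * expect \<nu> G) \<le> I * expect \<nu> (\<lambda>x. (f k x - c)\<^sup>2)" by (simp add: mult_ac)
    also have "I * expect \<nu> (\<lambda>x. (f k x - c)\<^sup>2) \<le> w\<^sup>2 * I + ?C * \<epsilon> k"
    proof (rule LIMSEQ_le[OF lim[OF sq]])
      show "(\<lambda>n. w\<^sup>2 * expect m (\<lambda>x. q (f n x)) + ?C * \<epsilon> k) \<longlonglongrightarrow> w\<^sup>2 * I + ?C * \<epsilon> k"
        by (intro tendsto_intros I)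
      have "expect m (\<lambda>x. (f k x - c)\<^sup>2 * q (f n x)) \<le> w\<^sup>2 * expect m (\<lambda>x. q (f n x)) + ?C * \<epsilon> k"
        if "k \<le> n" for n
      proof -
        have "(f k x - c)\<^sup>2 * q (f n x) \<le> w\<^sup>2 * q (f n x) + ?C * \<bar>f k x - f n x\<bar>" for x
        proof (cases "q (f n x) = 0")
          case True
          then show ?thesis using c by simp
        next
          case False
          have "(f n x - c)\<^sup>2 \<le> w\<^sup>2" using supp[OF False] by (intro power_mono) auto
          moreover have "(f k x - c)\<^sup>2 - (f n x - c)\<^sup>2 \<le> ?C * \<bar>f k x - f n x\<bar>"
          proof -
            have "(f k x - c)\<^sup>2 - (f n x - c)\<^sup>2 = (f k x + f n x - 2 * c) * (f k x - f n x)"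
              by (simp add: power2_eq_square algebra_simps)
            also have "\<dots> \<le> \<bar>f k x + f n x - 2 * c\<bar> * \<bar>f k x - f n x\<bar>"
              by (simp add: abs_mult[symmetric])
            also have "\<dots> \<le> ?C * \<bar>f k x - f n x\<bar>"
              using f2[of k x] f2[of n x] c by (intro mult_right_mono) auto
            finally show ?thesis .
          qed
          ultimately have "(f k x - c)\<^sup>2 \<le> w\<^sup>2 + ?C * \<bar>f k x - f n x\<bar>" by simp
          then have "(f k x - c)\<^sup>2 * q (f n x) \<le> (w\<^sup>2 + ?C * \<bar>f k x - f n x\<bar>) * q (f n x)"
            by (intro mult_right_mono q01)
          also have "\<dots> = w\<^sup>2 * q (f n x) + ?C * \<bar>f k x - f n x\<bar> * q (f n x)"
            by (simp add: distrib_right)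
          also have "\<dots> \<le> w\<^sup>2 * q (f n x) + ?C * \<bar>f k x - f n x\<bar>"
            using c by (intro add_left_mono mult_right_le_one_le q01) auto
          finally show ?thesis .
        qed
        then have "expect m (\<lambda>x. (f k x - c)\<^sup>2 * q (f n x)) \<le> expect m (\<lambda>x. w\<^sup>2 * q (f n x) + ?C * \<bar>f k x - f n x\<bar>)"
          by (intro expect_mono m bcontfun_mult plus_cont bcontfun_abs minus_cont const_bcontfun sq bf bcontfun_weight)
        also have "\<dots> = w\<^sup>2 * expect m (\<lambda>x. q (f n x)) + ?C * expect m (\<lambda>x. \<bar>f k x - f n x\<bar>)"
        proof -
          have d: "(\<lambda>x. \<bar>f k x - f n x\<bar>) \<in> bcontfun" by (intro bcontfun_abs minus_cont bf)
          show ?thesis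
            by (simp only: expect_add[OF bcontfun_mult[OF const_bcontfun bcontfun_weight] bcontfun_mult[OF const_bcontfun d]]
                expect_cmult[OF d] expect_cmult[OF bcontfun_weight])
        qed
        also have "\<dots> \<le> w\<^sup>2 * expect m (\<lambda>x. q (f n x)) + ?C * \<epsilon> k"
          using c by (intro add_left_mono mult_left_mono cauchy that) auto
        finally show ?thesis .
      qed
      then show "\<exists>N. \<forall>n\<ge>N. expect m (\<lambda>x. (f k x - c)\<^sup>2 * q (f n x)) \<le> w\<^sup>2 * expect m (\<lambda>x. q (f n x)) + ?C * \<epsilon> k"
        by blast
    qed
    finally show ?thesis .
  qed
  have "(\<lambda>k. w\<^sup>2 * I + ?C * \<epsilon> k) \<longlonglongrightarrow> w\<^sup>2 * I + ?C * 0"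
    by (intro tendsto_intros \<epsilon>0)
  then have "c\<^sup>2 * (I * expect \<nu> G) \<le> w\<^sup>2 * I + ?C * 0"
    by (rule LIMSEQ_le_const) (use main in blast)
  then show thesis using that[OF lim[OF bG] I] by simp
qed

end

text \<open>On the slice at level \<open>l * w\<close> of a grid of mesh \<open>w = 1 / N\<^sup>2\<close>, \<open>slice_bound\<close> bounds \<open>G\<close>
  by \<open>4 / l\<^sup>2\<close>; levels below \<open>N * w\<close> contribute little to the positive part.\<close>

lemma positive_part_null: "(\<lambda>n. expect m (\<lambda>x. G x * max (f n x) 0)) \<longlonglongrightarrow> 0"
proof -
  have nonneg: "0 \<le> expect m (\<lambda>x. G x * max (f n x) 0)" for n
    by (intro expect_nonneg m bcontfun_mult bcontfun_max bG bf const_bcontfun mult_nonneg_nonneg G01) auto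
  have bound: "\<forall>\<^sub>F n in sequentially. expect m (\<lambda>x. G x * max (f n x) 0) < 10 / real N + e"
    if N: "0 < N" and e: "0 < e" for N :: nat and e :: real
  proof -
    define w where "w = 1 / (real N)\<^sup>2"
    have w: "0 < w" using N by (simp add: w_def)
    \<comment> \<open>\<open>u l\<close> rises from 0 to 1 between l w and (l + 1) w. The difference
      \<open>q l\<close> is therefore a tent supported on an interval of length 2 w, and the tents
      telescope to a partition of unity.\<close>
    define u where "u l s = ramp (s / w - real l)" for l :: nat and s
    define q where "q l s = u l s - u (Suc l) s" for l s
    have uL: "\<bar>u l s - u l t\<bar> \<le> 1 / w * \<bar>s - t\<bar>" for l s t
    proof -
      have "\<bar>u l s - u l t\<bar> \<le> \<bar>(s / w - real l) - (t / w - real l)\<bar>"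
        unfolding u_def by (rule ramp_lipschitz)
      also have "\<dots> = 1 / w * \<bar>s - t\<bar>" using w by (simp add: diff_divide_distrib[symmetric] abs_divide)
      finally show ?thesis .
    qed
    have qL: "\<bar>q l s - q l t\<bar> \<le> (2 / w) * \<bar>s - t\<bar>" for l s t
      using uL[of l s t] uL[of "Suc l" s t] unfolding q_def by (simp add: abs_le_iff) 
    have q0: "0 \<le> q l s" for l s
      unfolding q_def u_def using ramp_mono[of "s / w - real (Suc l)" "s / w - real l"] by simp
    have q1: "q l s \<le> 1" for l s
      unfolding q_def u_def by (rule ramp_diff_le)
    have qs: "real l * w \<le> s \<and> s \<le> real l * w + 2 * w" if "q l s \<noteq> 0" for l s
    proof -
      have "real l \<le> s / w \<and> s / w \<le> real l + 2"
        using that unfolding q_def u_def ramp_def by (auto simp: min_def max_def split: if_splits)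
      then show ?thesis using w by (simp add: field_simps)
    qed
    define J where "J l = lim (\<lambda>n. expect m (\<lambda>x. G x * q l (f n x)))" for l
    define I where "I l = lim (\<lambda>n. expect m (\<lambda>x. q l (f n x)))" for l
    have lims: "(\<lambda>n. expect m (\<lambda>x. G x * q l (f n x))) \<longlonglongrightarrow> J l \<and>
        (\<lambda>n. expect m (\<lambda>x. q l (f n x))) \<longlonglongrightarrow> I l \<and> (real l * w)\<^sup>2 * J l \<le> (2 * w)\<^sup>2 * I l"
      if "N \<le> l" for l
    proof -
      have "0 < real l * w" using N that w by simp
      obtain j i where j: "(\<lambda>n. expect m (\<lambda>x. G x * q l (f n x))) \<longlonglongrightarrow> j"
        and i: "(\<lambda>n. expect m (\<lambda>x. q l (f n x))) \<longlonglongrightarrow> i" and ji: "(real l * w)\<^sup>2 * j \<le> (2 * w)\<^sup>2 * i"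
        by (rule slice_bound[of "q l" "2 / w" "real l * w" "2 * w"])
           (assumption | rule q0 q1 qL qs \<open>0 < real l * w\<close> that)+
      have "J l = j" "I l = i" unfolding J_def I_def by (rule limI[OF j], rule limI[OF i])
      with j i ji show ?thesis by simp
    qed
    note J = lims[THEN conjunct1] and I = lims[THEN conjunct2, THEN conjunct1]
      and JI = lims[THEN conjunct2, THEN conjunct2]
    \<comment> \<open>The upper end is the level 2 = 2 N^2 w, which f_n never exceeds, so
      \<open>u (2 * N\<^sup>2)\<close> vanishes there and the tents add up to
      \<open>u N\<close>.\<close>
    let ?L = "{N..<2 * N\<^sup>2}"
    have bq: "(\<lambda>x. q l (f n x)) \<in> bcontfun" for l n
      by (rule bcontfun_weight[OF q0 q1 qL])
    have bGq: "(\<lambda>x. G x * q l (f n x)) \<in> bcontfun" for l n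
      by (rule bcontfun_mult[OF bG bq])
    have tele: "(\<Sum>l\<in>?L. q l s) = u N s - u (2 * N\<^sup>2) s" for s
    proof -
      have "N \<le> 2 * N\<^sup>2" by (simp add: power2_eq_square)
      from sum_Suc_diff'[OF this, of "\<lambda>l. - u l s"] show ?thesis by (simp add: q_def)
    qed
    have I0: "0 \<le> I l" if "N \<le> l" for l
      by (rule LIMSEQ_le_const[OF I[OF that]]) (auto intro!: expect_nonneg m bq q0)
    have sumI: "(\<Sum>l\<in>?L. I l) \<le> 1"
    proof (rule LIMSEQ_le_const2)
      show "(\<lambda>n. \<Sum>l\<in>?L. expect m (\<lambda>x. q l (f n x))) \<longlonglongrightarrow> (\<Sum>l\<in>?L. I l)"
        by (intro tendsto_sum I) auto
      have "(\<Sum>l\<in>?L. expect m (\<lambda>x. q l (f n x))) \<le> 1" for n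
      proof -
        have "(\<Sum>l\<in>?L. expect m (\<lambda>x. q l (f n x))) = expect m (\<lambda>x. \<Sum>l\<in>?L. q l (f n x))"
          by (rule expect_sum[symmetric]) (rule bq)
        also have "\<dots> \<le> expect m (\<lambda>x. 1)"
          by (intro expect_mono m bcontfun_sum bq const_bcontfun)
             (simp add: tele u_def ramp_diff_le)
        finally show ?thesis using m by simp
      qed
      then show "\<exists>M. \<forall>n\<ge>M. (\<Sum>l\<in>?L. expect m (\<lambda>x. q l (f n x))) \<le> 1" by blast
    qed
    have J_le: "J l \<le> 4 / (real N)\<^sup>2 * I l" if l: "N \<le> l" for l
    proof -
      have "(real l)\<^sup>2 * J l \<le> 4 * I l"
        using JI[OF l] w by (simp add: power_mult_distrib)
      moreover have "(real l)\<^sup>2 > 0" using l N by simp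
      ultimately have "J l \<le> 4 * I l / (real l)\<^sup>2" by (simp add: pos_le_divide_eq mult.commute)
      also have "\<dots> \<le> 4 * I l / (real N)\<^sup>2"
        using l N I0[OF l] by (intro divide_left_mono mult_pos_pos power_mono) auto
      finally show ?thesis by simp
    qed
    have "(\<Sum>l\<in>?L. J l) \<le> (\<Sum>l\<in>?L. 4 / (real N)\<^sup>2 * I l)" by (intro sum_mono J_le) auto
    also have "\<dots> = 4 / (real N)\<^sup>2 * (\<Sum>l\<in>?L. I l)" by (simp add: sum_distrib_left)
    also have "\<dots> \<le> 4 / (real N)\<^sup>2 * 1" by (intro mult_left_mono sumI) simp
    finally have sumJ: "(\<Sum>l\<in>?L. J l) \<le> 4 / (real N)\<^sup>2" by simp
    have le: "expect m (\<lambda>x. G x * max (f n x) 0)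
        \<le> (real N + 1) * w + 2 * (\<Sum>l\<in>?L. expect m (\<lambda>x. G x * q l (f n x)))" for n
    proof -
      have pw: "G x * max (f n x) 0 \<le> (real N + 1) * w + 2 * (\<Sum>l\<in>?L. G x * q l (f n x))" for x
      proof -
        let ?s = "f n x"
        have "?s \<le> 2" using f2[of n x] by simp
        then have "?s / w \<le> 2 * (real N)\<^sup>2" using N by (simp add: w_def)
        then have u0: "u (2 * N\<^sup>2) ?s = 0" by (simp add: u_def ramp_def)
        have w0: "0 \<le> (real N + 1) * w" using w by simp
        \<comment> \<open>Above the level (N + 1) w the weight \<open>u N\<close> is 1, and the
          factor 2 is the upper bound of f_n; below that level the first summand suffices.\<close>
        have key: "max ?s 0 \<le> (real N + 1) * w + 2 * u N ?s"
        proof (cases "?s \<le> (real N + 1) * w")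
          case True
          moreover have "0 \<le> u N ?s" unfolding u_def by (rule ramp_bounds)
          ultimately show ?thesis using w0 by linarith
        next
          case False
          then have "real N + 1 \<le> ?s / w" using w by (simp add: field_simps)
          then have "u N ?s = 1" by (simp add: u_def ramp_def)
          then show ?thesis using \<open>?s \<le> 2\<close> w0 by linarith
        qed
        have "G x * max ?s 0 \<le> G x * ((real N + 1) * w) + G x * (2 * u N ?s)"
          using mult_left_mono[OF key G01(1)[of x]] by (simp add: distrib_left)
        also have "G x * ((real N + 1) * w) \<le> (real N + 1) * w"
          using w by (intro mult_left_le_one_le G01) auto
        finally show ?thesis
          using tele[of ?s] u0 by (simp add: sum_distrib_left[symmetric] mult_ac)
      qed
      have bs: "(\<lambda>x. \<Sum>l\<in>?L. G x * q l (f n x)) \<in> bcontfun" by (intro bcontfun_sum bGq)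
      have "expect m (\<lambda>x. G x * max (f n x) 0)
          \<le> expect m (\<lambda>x. (real N + 1) * w + 2 * (\<Sum>l\<in>?L. G x * q l (f n x)))"
        by (intro expect_mono m bcontfun_mult[OF bG] bcontfun_max bf const_bcontfun plus_cont
            bcontfun_mult[OF const_bcontfun bs] pw)
      also have "\<dots> = (real N + 1) * w + 2 * (\<Sum>l\<in>?L. expect m (\<lambda>x. G x * q l (f n x)))"
        by (simp only: expect_add[OF const_bcontfun bcontfun_mult[OF const_bcontfun bs]]
            expect_cmult[OF bs] expect_const[OF m] expect_sum[OF bGq])
      finally show ?thesis .
    qed
    have "(\<lambda>n. (real N + 1) * w + 2 * (\<Sum>l\<in>?L. expect m (\<lambda>x. G x * q l (f n x))))
        \<longlonglongrightarrow> (real N + 1) * w + 2 * (\<Sum>l\<in>?L. J l)"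
      by (intro tendsto_intros J) auto
    \<comment> \<open>The slices contribute 2 * 4 / N^2 and the low levels (N + 1) / N^2, together
      (N + 9) / N^2, which is at most 10 / N since N \<ge> 1.\<close>
    moreover have "(real N + 1) * w + 2 * (\<Sum>l\<in>?L. J l) < 10 / real N + e"
    proof -
      have "(real N + 1) * w + 2 * (\<Sum>l\<in>?L. J l) \<le> (real N + 9) / (real N)\<^sup>2"
        using sumJ by (simp add: w_def add_divide_distrib)
      also have "\<dots> \<le> 10 / real N" using N by (simp add: field_simps power2_eq_square)
      finally show ?thesis using e by simp
    qed
    ultimately have "\<forall>\<^sub>F n in sequentially. (real N + 1) * w + 2 * (\<Sum>l\<in>?L. expect m (\<lambda>x. G x * q l (f n x)))
        < 10 / real N + e"
      by (rule order_tendstoD(2))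
    then show ?thesis by eventually_elim (use le in \<open>auto intro: le_less_trans\<close>)
  qed
  show ?thesis
  proof (rule order_tendstoI)
    fix e :: real assume "e < 0"
    then show "\<forall>\<^sub>F n in sequentially. e < expect m (\<lambda>x. G x * max (f n x) 0)"
      by (intro always_eventually allI less_le_trans[OF _ nonneg])
  next
    fix e :: real assume e: "0 < e"
    obtain N :: nat where N: "20 / e < real N" using reals_Archimedean2 by blast
    then have "0 < N" using e by (metis divide_pos_pos less_trans of_nat_0_less_iff zero_less_numeral)
    with N e have "10 / real N + e / 2 < e" by (simp add: field_simps)
    with bound[OF \<open>0 < N\<close>, of "e/2"] e
    show "\<forall>\<^sub>F n in sequentially. expect m (\<lambda>x. G x * max (f n x) 0) < e"
      by (auto elim!: eventually_mono)
  qed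
qed

subsection \<open>Restriction to the positive set\<close>

text \<open>The set where the limit of \<open>f\<close> is positive, approximated by superlevel sets
  whose thresholds tend to zero more slowly than \<open>\<epsilon>\<close>.\<close>

definition superlevel :: "nat \<Rightarrow> 'a set" where
  "superlevel n = {x. 1 / real (n + 1) < f n x}"

text \<open>An indicator of f_n is not a Lipschitz function of it, so the Cauchy property must come
  from comparison with a ramp of fixed slope i. On the superlevel set the ramp of slope n + 1 equals
  1; off it the ramp of slope i is at most i/(n+1). Hence the distance is controlled by the gap
  between the means of the two ramps, and these means increase with the slope to a common
  limit.\<close>

lemma superlevel_approx:
  assumes e: "0 < e"
  obtains i :: nat where
    "\<forall>\<^sub>F n in sequentially. expect m (\<lambda>x. \<bar>indicator (superlevel n) x - ramp (real i * f n x)\<bar>) < e"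
proof -
  define p where "p i s = ramp (real i * s)" for i :: nat and s
  have p0: "0 \<le> p i s" and p1: "p i s \<le> 1" for i s by (simp_all add: p_def ramp_bounds)
  have pL: "\<bar>p i s - p i t\<bar> \<le> real i * \<bar>s - t\<bar>" for i s t
    using ramp_lipschitz[of "real i * s" "real i * t"] by (simp add: p_def right_diff_distrib[symmetric] abs_mult)
  have bp: "(\<lambda>x. p i (f n x)) \<in> bcontfun" for i n by (rule bcontfun_weight[OF p0 p1 pL])
  have "convergent (\<lambda>n. expect m (\<lambda>x. p i (f n x)))" for i
    by (rule weight_limit[OF p0 p1 pL, of i]) (auto simp: convergent_def)
  then obtain I where I: "\<And>i. (\<lambda>n. expect m (\<lambda>x. p i (f n x))) \<longlonglongrightarrow> I i"
    unfolding convergent_def by metis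
  have near: "\<bar>expect m (\<lambda>x. p i (f n x)) - I i\<bar> \<le> real i * \<epsilon> n" for i n
  proof (rule LIMSEQ_le_const2)
    show "(\<lambda>k. \<bar>expect m (\<lambda>x. p i (f n x)) - expect m (\<lambda>x. p i (f k x))\<bar>)
        \<longlonglongrightarrow> \<bar>expect m (\<lambda>x. p i (f n x)) - I i\<bar>"
      by (intro tendsto_intros I)
    have "\<bar>expect m (\<lambda>x. p i (f n x)) - expect m (\<lambda>x. p i (f k x))\<bar> \<le> real i * \<epsilon> n" if "n \<le> k" for k
      using abs_expect_le[OF m minus_cont[OF bp[of i n] bp[of i k]]]
        weight_cauchy[OF p0 p1 pL order_refl that, of i] by (simp add: expect_diff bp)
    then show "\<exists>N. \<forall>k\<ge>N. \<bar>expect m (\<lambda>x. p i (f n x)) - expect m (\<lambda>x. p i (f k x))\<bar> \<le> real i * \<epsilon> n"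
      by blast
  qed
  have p_mono: "p i s \<le> p j s" if "i \<le> j" for i j s
  proof (cases "0 \<le> s")
    case True
    then show ?thesis unfolding p_def using that by (intro ramp_mono mult_right_mono) auto
  next
    case False
    then have "real i * s \<le> 0" by (simp add: mult_nonneg_nonpos)
    then show ?thesis by (simp add: p_def ramp_def)
  qed
  have "incseq I"
    unfolding incseq_def
    by (intro allI impI LIMSEQ_le[OF I I] exI[of _ 0] expect_mono m bp p_mono)
  have I1: "I i \<le> 1" for i
  proof (rule LIMSEQ_le_const2[OF I])
    have "expect m (\<lambda>x. p i (f n x)) \<le> 1" for n
      using expect_mono[OF m bp[of i n] const_bcontfun[of 1] p1] m by simp
    then show "\<exists>N. \<forall>n\<ge>N. expect m (\<lambda>x. p i (f n x)) \<le> 1" by blast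
  qed
  obtain c where c: "I \<longlonglongrightarrow> c" "\<forall>i. I i \<le> c"
    using incseq_convergent[OF \<open>incseq I\<close>, of 1] I1 by blast
  have "\<forall>\<^sub>F i in sequentially. c - e < I i" using order_tendstoD(1)[OF c(1), of "c - e"] e by simp
  then obtain i where i: "c - e < I i" unfolding eventually_sequentially by blast
  \<comment> \<open>Besides the gap \<open>c - I i\<close>, the errors come from replacing the two
    ramp means at index n by their limits, with slopes n + 1 and i, and from points below the
    threshold. The term \<open>real (n + 1) * \<epsilon> n\<close> is the reason for the assumption
    \<open>\<epsilon>1\<close>.\<close>
  define r where "r n = c - I i + (real (n + 1) * \<epsilon> n + real i * \<epsilon> n + real i / real (n + 1))" for n
  have le: "expect m (\<lambda>x. \<bar>indicator (superlevel n) x - p i (f n x)\<bar>) \<le> r n" if n: "i \<le> n + 1" for n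
  proof -
    let ?s = "superlevel n"
    have pw: "\<bar>indicator ?s x - p i (f n x)\<bar> \<le> (p (n + 1) (f n x) - p i (f n x)) + real i / real (n + 1)" for x
    proof (cases "x \<in> ?s")
      case True
      then have "p (n + 1) (f n x) = 1"
        by (simp add: superlevel_def p_def ramp_def field_simps)
      then show ?thesis using True p1[of i "f n x"] by simp
    next
      case False
      then have "real i * f n x \<le> real i * (1 / real (n + 1))"
        by (intro mult_left_mono) (auto simp: superlevel_def)
      then have "p i (f n x) \<le> real i / real (n + 1)" by (simp add: p_def ramp_def min.coboundedI2)
      then show ?thesis using False p0[of i "f n x"] p_mono[OF n, of "f n x"] by simp
    qed
    have "expect m (\<lambda>x. \<bar>indicator ?s x - p i (f n x)\<bar>)
        \<le> expect m (\<lambda>x. (p (n + 1) (f n x) - p i (f n x)) + real i / real (n + 1))"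
      by (intro expect_mono m bcontfun_abs minus_cont plus_cont bcontfun_indicator const_bcontfun bp pw)
    also have "\<dots> = expect m (\<lambda>x. p (n + 1) (f n x)) - expect m (\<lambda>x. p i (f n x)) + real i / real (n + 1)"
      by (simp only: expect_add[OF minus_cont[OF bp bp] const_bcontfun] expect_diff[OF bp bp] expect_const[OF m])
    also have "\<dots> \<le> r n"
      using near[of "n + 1" n] near[of i n] c(2)[rule_format, of "n + 1"] by (simp add: r_def abs_le_iff)
    finally show ?thesis .
  qed
  have "(\<lambda>n. real i / real (n + 1)) \<longlonglongrightarrow> 0"
    using LIMSEQ_Suc[OF lim_const_over_n[of "real i"]] by simp
  then have "r \<longlonglongrightarrow> c - I i + (0 + real i * 0 + 0)"
    unfolding r_def by (intro tendsto_intros \<epsilon>0 \<epsilon>1)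
  then have "\<forall>\<^sub>F n in sequentially. r n < e" using i by (intro order_tendstoD(2)) auto
  moreover have "\<forall>\<^sub>F n in sequentially. i \<le> n + 1"
    unfolding eventually_sequentially by (intro exI[of _ i]) simp
  ultimately have "\<forall>\<^sub>F n in sequentially. expect m (\<lambda>x. \<bar>indicator (superlevel n) x - p i (f n x)\<bar>) < e"
    by eventually_elim (use le in \<open>auto intro: le_less_trans\<close>)
  then show thesis using that unfolding p_def by blast
qed

text \<open>A \<beta>-restriction is defined through sets rather than densities, so here genuine
  indicators are fed to \<open>density_limit\<close>. They inherit the Cauchy property and the
  asymptotic invariance from a nearby ramp, each by a three-term estimate.\<close>

lemma superlevel_limit:
  obtains c \<nu> where "\<nu> \<in> invariant_means" "0 \<le> c" "(\<lambda>n. meas m (superlevel n)) \<longlonglongrightarrow> c"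
    and "\<And>g. g \<in> bcontfun \<Longrightarrow> (\<lambda>n. expect m (\<lambda>x. g x * indicator (superlevel n) x)) \<longlonglongrightarrow> c * expect \<nu> g"
    and "\<And>e. 0 < e \<Longrightarrow> \<exists>N. \<forall>n\<ge>N. \<forall>n'\<ge>N. meas m (sym_diff (superlevel n) (superlevel n')) < e"
proof -
  let ?h = "\<lambda>n. indicator (superlevel n) :: 'a \<Rightarrow> real"
  have ramp_L: "\<bar>ramp (real i * s) - ramp (real i * t)\<bar> \<le> real i * \<bar>s - t\<bar>" for i s t
    using ramp_lipschitz[of "real i * s" "real i * t"] by (simp add: right_diff_distrib[symmetric] abs_mult)
  have bh: "?h n \<in> bcontfun" for n by (rule bcontfun_indicator)
  have cau: "\<exists>N. \<forall>n\<ge>N. \<forall>n'\<ge>N. expect m (\<lambda>x. \<bar>?h n x - ?h n' x\<bar>) < e" if e: "0 < e" for e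
  proof -
    obtain i where "\<forall>\<^sub>F n in sequentially. expect m (\<lambda>x. \<bar>?h n x - ramp (real i * f n x)\<bar>) < e / 3"
      using superlevel_approx[of "e / 3"] e by auto
    then obtain N where N: "\<And>n. n \<ge> N \<Longrightarrow> expect m (\<lambda>x. \<bar>?h n x - ramp (real i * f n x)\<bar>) < e / 3"
      unfolding eventually_sequentially by blast
    obtain N' where N': "real i * \<epsilon> N' < e / 3" using \<epsilon>_small[of "e / 3" "real i"] e by auto
    have "expect m (\<lambda>x. \<bar>?h n x - ?h n' x\<bar>) < e" if n: "max N N' \<le> n" "max N N' \<le> n'" for n n'
    proof -
      have "expect m (\<lambda>x. \<bar>ramp (real i * f n x) - ramp (real i * f n' x)\<bar>) \<le> real i * \<epsilon> N'"
        using n by (intro weight_cauchy[where q="\<lambda>s. ramp (real i * s)"] ramp_bounds ramp_L) auto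
      moreover have "expect m (\<lambda>x. \<bar>ramp (real i * f n' x) - ?h n' x\<bar>) < e / 3"
        using N[of n'] n by (simp add: abs_minus_commute)
      moreover have "expect m (\<lambda>x. \<bar>?h n x - ramp (real i * f n x)\<bar>) < e / 3" using N[of n] n by simp
      moreover note expect_abs_triangle[OF m bh[of n] bcontfun_ramp[of "\<lambda>x. real i * f n x"] bh[of n']]
        expect_abs_triangle[OF m bcontfun_ramp[of "\<lambda>x. real i * f n x"] bcontfun_ramp[of "\<lambda>x. real i * f n' x"] bh[of n']]
      ultimately show ?thesis using N' by linarith
    qed
    then show ?thesis by blast
  qed
  have shift: "(\<lambda>n. expect m (\<lambda>x. \<bar>?h n x - ?h n (x - \<gamma>)\<bar>)) \<longlonglongrightarrow> 0" for \<gamma>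
  proof (rule order_tendstoI)
    fix e :: real assume e: "e < 0"
    have "0 \<le> expect m (\<lambda>x. \<bar>?h n x - ?h n (x - \<gamma>)\<bar>)" for n
      by (intro expect_nonneg m bcontfun_abs minus_cont bh bcontfun_shift) simp
    then show "\<forall>\<^sub>F n in sequentially. e < expect m (\<lambda>x. \<bar>?h n x - ?h n (x - \<gamma>)\<bar>)"
      using e by (intro always_eventually allI) (rule less_le_trans)
  next
    fix e :: real assume e: "0 < e"
    obtain i where i: "\<forall>\<^sub>F n in sequentially. expect m (\<lambda>x. \<bar>?h n x - ramp (real i * f n x)\<bar>) < e / 3"
      using superlevel_approx[of "e / 3"] e by auto
    have "(\<lambda>n. real i * \<epsilon> n) \<longlonglongrightarrow> 0" using tendsto_mult_left[OF \<epsilon>0, of "real i"] by simp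
    then have "\<forall>\<^sub>F n in sequentially. real i * \<epsilon> n < e / 3" using e by (intro order_tendstoD(2)) auto
    with i show "\<forall>\<^sub>F n in sequentially. expect m (\<lambda>x. \<bar>?h n x - ?h n (x - \<gamma>)\<bar>) < e"
    proof eventually_elim
      case (elim n)
      let ?p = "\<lambda>x. ramp (real i * f n x)"
      have bp: "?p \<in> bcontfun" by (rule bcontfun_ramp)
      have "expect m (\<lambda>x. \<bar>?p x - ?p (x - \<gamma>)\<bar>) \<le> real i * \<epsilon> n"
        by (intro weight_almost_inv[where q="\<lambda>s. ramp (real i * s)"] ramp_bounds ramp_L)
      moreover have "expect m (\<lambda>x. \<bar>?p (x - \<gamma>) - ?h n (x - \<gamma>)\<bar>) = expect m (\<lambda>x. \<bar>?h n x - ?p x\<bar>)"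
        using expect_shift[OF inv bcontfun_abs[OF minus_cont[OF bh[of n] bp]], of \<gamma>] by (simp add: abs_minus_commute)
      moreover note expect_abs_triangle[OF m bh[of n] bp bcontfun_shift[OF bh[of n], of \<gamma>]]
        expect_abs_triangle[OF m bp bcontfun_shift[OF bp, of \<gamma>] bcontfun_shift[OF bh[of n], of \<gamma>]]
      ultimately show ?case using elim by linarith
    qed
  qed
  obtain c \<nu> where *: "\<nu> \<in> invariant_means" "0 \<le> c" "(\<lambda>n. expect m (?h n)) \<longlonglongrightarrow> c"
    "\<And>g. g \<in> bcontfun \<Longrightarrow> (\<lambda>n. expect m (\<lambda>x. g x * ?h n x)) \<longlonglongrightarrow> c * expect \<nu> g"
    by (rule density_limit[OF inv, of ?h]) (use cau shift in \<open>simp_all add: indicator_def\<close>)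
  have sd: "indicator (sym_diff C D) = (\<lambda>x. \<bar>indicator C x - indicator D x :: real\<bar>)" for C D :: "'a set"
    by (auto simp: indicator_def)
  show thesis
    by (rule that[OF *(1,2) _ *(4)]) (use *(3) cau in \<open>simp_all add: meas_eq_expect sd\<close>)
qed

text \<open>Adds to the limit the two facts for which the positive set was chosen: discarding its
  complement does not lower the integral of F, and G has no mass on it. They are stated with the
  factor \<open>c\<close>, which may still be 0 here.\<close>

lemma superlevel_restriction:
  obtains c \<nu> where "\<nu> \<in> invariant_means" "0 \<le> c" "(\<lambda>n. meas m (superlevel n)) \<longlonglongrightarrow> c"
    and "\<And>g. g \<in> bcontfun \<Longrightarrow> (\<lambda>n. expect m (\<lambda>x. g x * indicator (superlevel n) x)) \<longlonglongrightarrow> c * expect \<nu> g"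
    and "\<And>e. 0 < e \<Longrightarrow> \<exists>N. \<forall>n\<ge>N. \<forall>n'\<ge>N. meas m (sym_diff (superlevel n) (superlevel n')) < e"
    and "expect m F \<le> c * expect \<nu> F" "c * expect \<nu> G = 0"
proof -
  let ?h = "\<lambda>n. indicator (superlevel n) :: 'a \<Rightarrow> real"
  have bh: "?h n \<in> bcontfun" for n by (rule bcontfun_indicator)
  obtain c \<nu> where \<nu>: "\<nu> \<in> invariant_means" and c: "0 \<le> c" "(\<lambda>n. meas m (superlevel n)) \<longlonglongrightarrow> c"
    and lim: "\<And>g. g \<in> bcontfun \<Longrightarrow> (\<lambda>n. expect m (\<lambda>x. g x * ?h n x)) \<longlonglongrightarrow> c * expect \<nu> g"
    and cau: "\<And>e. 0 < e \<Longrightarrow> \<exists>N. \<forall>n\<ge>N. \<forall>n'\<ge>N. meas m (sym_diff (superlevel n) (superlevel n')) < e"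
    by (rule superlevel_limit) blast
  have inv0: "(\<lambda>n. 1 / real (n + 1)) \<longlonglongrightarrow> 0"
    using LIMSEQ_Suc[OF lim_const_over_n[of "1::real"]] by simp
  \<comment> \<open>Off the superlevel set f_n is at most 1/(n+1), so removing the complement loses
    at most that much. Exchanging f_n for the fixed f_k costs \<open>\<epsilon> k\<close> and lets
    the limit be evaluated through \<nu>(f_k) = \<nu>(F).\<close>
  have "expect m F - \<epsilon> k \<le> c * expect \<nu> F" for k
  proof -
    have "(\<lambda>n. expect m (\<lambda>x. f k x * ?h n x)) \<longlonglongrightarrow> c * expect \<nu> F"
      using lim[OF bf, of k] avg[OF \<nu>] by simp
    moreover have "(\<lambda>n. expect m F - \<epsilon> k - 1 / real (n + 1)) \<longlonglongrightarrow> expect m F - \<epsilon> k - 0"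
      by (intro tendsto_intros inv0)
    moreover have "expect m F - \<epsilon> k - 1 / real (n + 1) \<le> expect m (\<lambda>x. f k x * ?h n x)" if n: "k \<le> n" for n
    proof -
      have "expect m (f n) \<le> expect m (\<lambda>x. f n x * ?h n x + 1 / real (n + 1))"
        by (intro expect_mono m bf plus_cont bcontfun_mult bh const_bcontfun)
           (auto simp: superlevel_def indicator_def)
      also have "\<dots> = expect m (\<lambda>x. f n x * ?h n x) + 1 / real (n + 1)"
        by (simp only: expect_add[OF bcontfun_mult[OF bf bh] const_bcontfun] expect_const[OF m])
      finally have "expect m F \<le> expect m (\<lambda>x. f n x * ?h n x) + 1 / real (n + 1)"
        by (simp add: avg[OF inv])
      moreover have "\<bar>expect m (\<lambda>x. ?h n x * f n x) - expect m (\<lambda>x. ?h n x * f k x)\<bar>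
          \<le> 1 * expect m (\<lambda>x. \<bar>f n x - f k x\<bar>)"
        by (intro expect_mult_diff_le m bh bf) (simp add: indicator_def)
      moreover have "expect m (\<lambda>x. \<bar>f n x - f k x\<bar>) \<le> \<epsilon> k" using n by (intro cauchy) auto
      ultimately show ?thesis by (simp add: mult.commute abs_le_iff)
    qed
    ultimately have "expect m F - \<epsilon> k - 0 \<le> c * expect \<nu> F"
      by (intro LIMSEQ_le) blast+
    then show ?thesis by simp
  qed
  moreover have "(\<lambda>k. expect m F - \<epsilon> k) \<longlonglongrightarrow> expect m F - 0"
    by (intro tendsto_intros \<epsilon>0)
  ultimately have F: "expect m F \<le> c * expect \<nu> F"
    by (intro LIMSEQ_le_const2[of "\<lambda>k. expect m F - \<epsilon> k"]) auto
  \<comment> \<open>The ramp of slope i is at most i times the positive part of f_n, so for fixed i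
    \<open>positive_part_null\<close> applies; the remainder is the approximation error of the
    indicator.\<close>
  have "c * expect \<nu> G \<le> 0 + e" if e: "0 < e" for e
  proof -
    obtain i where i: "\<forall>\<^sub>F n in sequentially. expect m (\<lambda>x. \<bar>?h n x - ramp (real i * f n x)\<bar>) < e / 2"
      using superlevel_approx[of "e / 2"] e by auto
    have "(\<lambda>n. real i * expect m (\<lambda>x. G x * max (f n x) 0)) \<longlonglongrightarrow> 0"
      using tendsto_mult_left[OF positive_part_null, of "real i"] by simp
    then have "\<forall>\<^sub>F n in sequentially. real i * expect m (\<lambda>x. G x * max (f n x) 0) < e / 2"
      using e by (intro order_tendstoD(2)) auto
    with i have "\<forall>\<^sub>F n in sequentially. expect m (\<lambda>x. G x * ?h n x) \<le> e"
    proof eventually_elim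
      case (elim n)
      let ?p = "\<lambda>x. ramp (real i * f n x)" and ?g = "\<lambda>x. G x * max (f n x) 0"
      have bp: "?p \<in> bcontfun" by (rule bcontfun_ramp)
      have bg: "?g \<in> bcontfun" by (intro bcontfun_mult bG bcontfun_max bf const_bcontfun)
      have bd: "(\<lambda>x. \<bar>?h n x - ?p x\<bar>) \<in> bcontfun" by (intro bcontfun_abs minus_cont bh bp)
      have "G x * ?h n x \<le> real i * ?g x + \<bar>?h n x - ?p x\<bar>" for x
      proof -
        have "?p x \<le> real i * max (f n x) 0"
        proof -
          have "real i * f n x \<le> real i * max (f n x) 0" "0 \<le> real i * max (f n x) 0"
            by (intro mult_left_mono mult_nonneg_nonneg; simp)+
          then show ?thesis by (simp add: ramp_def min.coboundedI2)
        qed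
        from mult_left_mono[OF this G01(1)[of x]] have "G x * ?p x \<le> real i * ?g x" by (simp add: mult_ac)
        moreover have "G x * (?h n x - ?p x) \<le> \<bar>?h n x - ?p x\<bar>"
          using mult_left_mono[OF abs_ge_self[of "?h n x - ?p x"] G01(1)[of x]]
            mult_left_le_one_le[OF abs_ge_zero[of "?h n x - ?p x"] G01(1)[of x] G01(2)[of x]] by linarith
        ultimately show ?thesis by (simp add: right_diff_distrib)
      qed
      then have "expect m (\<lambda>x. G x * ?h n x) \<le> expect m (\<lambda>x. real i * ?g x + \<bar>?h n x - ?p x\<bar>)"
        by (intro expect_mono m bcontfun_mult[OF bG bh] plus_cont bcontfun_mult[OF const_bcontfun bg] bd)
      also have "\<dots> = real i * expect m ?g + expect m (\<lambda>x. \<bar>?h n x - ?p x\<bar>)"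
        by (simp only: expect_add[OF bcontfun_mult[OF const_bcontfun bg] bd] expect_cmult[OF bg])
      finally show ?case using elim by linarith
    qed
    from tendsto_upperbound[OF lim[OF bG] this] show ?thesis by simp
  qed
  then have "c * expect \<nu> G \<le> 0" by (rule field_le_epsilon)
  moreover have "0 \<le> c * expect \<nu> G"
    using \<nu> by (intro mult_nonneg_nonneg c expect_nonneg invariant_means_is_mean bG G01)
  ultimately show thesis using that[OF \<nu> c lim cau F] by simp
qed

end

subsection \<open>Cosets and the conclusion\<close>

lemma positive_restriction:
  fixes m :: "('a::{ab_group_add,discrete_topology} \<Rightarrow>\<^sub>C real) \<Rightarrow>\<^sub>L real"
  assumes inv: "m \<in> invariant_means"
    and F: "\<And>x. \<bar>F x\<bar> \<le> 2" and G: "\<And>x. 0 \<le> G x" "\<And>x. G x \<le> 1"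
    and ext: "\<And>\<nu>. \<nu> extreme_point_of invariant_means \<Longrightarrow> 0 < expect \<nu> F \<Longrightarrow> expect \<nu> G = 0"
  obtains C c \<nu> where "\<nu> \<in> invariant_means" "(\<lambda>n::nat. meas m (C n)) \<longlonglongrightarrow> c"
    and "\<And>g. g \<in> bcontfun \<Longrightarrow> (\<lambda>n. expect m (\<lambda>x. g x * indicator (C n) x)) \<longlonglongrightarrow> c * expect \<nu> g"
    and "\<And>e. 0 < e \<Longrightarrow> \<exists>N. \<forall>n\<ge>N. \<forall>n'\<ge>N. meas m (sym_diff (C n) (C n')) < e"
    and "0 \<le> c" "expect m F \<le> c * expect \<nu> F" "c * expect \<nu> G = 0"
proof -
  \<comment> \<open>\<open>S\<close> stands in for the averages of translates of F: it keeps just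
    the properties in use, namely the uniform bound, the integrals against all invariant means, and
    stability under midpoints and translations.\<close>
  define S where "S = {f :: 'a \<Rightarrow> real. (\<forall>x. \<bar>f x\<bar> \<le> 2) \<and> (\<forall>\<nu>\<in>invariant_means. expect \<nu> f = expect \<nu> F)}"
  \<comment> \<open>The square makes \<open>\<epsilon> n\<close> small compared with the thresholds
    1/(n+1) of the superlevel sets.\<close>
  define \<epsilon> where "\<epsilon> n = 1 / (real (n + 1))\<^sup>2" for n
  have bS: "f \<in> bcontfun" if "f \<in> S" for f
    using that by (intro bcontfun_discreteI[of _ 2]) (simp add: S_def)
  have FS: "F \<in> S" using F by (simp add: S_def)
  have mid: "(\<lambda>x. (f x + g x) / 2) \<in> S" if fg: "f \<in> S" "g \<in> S" for f g
  proof -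
    have avg: "expect \<nu> (\<lambda>x. (f x + g x) / 2) = (expect \<nu> f + expect \<nu> g) / 2" for \<nu>
      using expect_cmult[OF plus_cont[OF bS[OF fg(1)] bS[OF fg(2)]], of \<nu> "1/2"]
      by (simp add: expect_add bS fg)
    have "\<bar>(f x + g x) / 2\<bar> \<le> 2" for x
    proof -
      have "\<bar>f x\<bar> \<le> 2" "\<bar>g x\<bar> \<le> 2" using fg by (auto simp: S_def)
      then have "\<bar>f x + g x\<bar> \<le> 4" by linarith
      then show ?thesis by simp
    qed
    moreover have "expect \<nu> (\<lambda>x. (f x + g x) / 2) = expect \<nu> F" if "\<nu> \<in> invariant_means" for \<nu>
      unfolding avg using fg that by (simp add: S_def)
    ultimately show ?thesis unfolding S_def by simp
  qed
  have shift: "(\<lambda>x. f (x - \<gamma>)) \<in> S" if "f \<in> S" for f \<gamma>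
    using that expect_shift[OF _ bS[OF that], of _ \<gamma>] by (simp add: S_def)
  have \<epsilon>_pos: "0 < \<epsilon> n" for n by (simp add: \<epsilon>_def)
  have \<epsilon>_dec: "decseq \<epsilon>"
    unfolding decseq_def \<epsilon>_def by (intro allI impI divide_left_mono power_mono mult_pos_pos) auto
  have inv0: "(\<lambda>n. 1 / real (n + 1)) \<longlonglongrightarrow> 0"
    using LIMSEQ_Suc[OF lim_const_over_n[of "1::real"]] by simp
  have \<epsilon>1: "(\<lambda>n. real (n + 1) * \<epsilon> n) \<longlonglongrightarrow> 0"
    using inv0 by (simp add: \<epsilon>_def power2_eq_square)
  have \<epsilon>0: "\<epsilon> \<longlonglongrightarrow> 0"
    using tendsto_mult[OF inv0 inv0] by (simp add: \<epsilon>_def[abs_def] power2_eq_square)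
  have Ssub: "S \<subseteq> bcontfun" using bS by (rule subsetI)
  have Sne: "S \<noteq> {}" using FS by (rule ex_in_conv[THEN iffD1, OF exI])
  obtain f where f: "\<And>n. f n \<in> S"
    and cau: "\<And>N n n'. N \<le> n \<Longrightarrow> N \<le> n' \<Longrightarrow> expect m (\<lambda>x. \<bar>f n x - f n' x\<bar>) \<le> \<epsilon> N"
    and ai: "\<And>n \<gamma>. expect m (\<lambda>x. \<bar>f n x - f n (x - \<gamma>)\<bar>) \<le> \<epsilon> n"
    by (rule minimizing_sequence[OF inv Ssub Sne _ _ \<epsilon>_pos \<epsilon>_dec])
       (erule (1) mid, erule shift, rule that)
  interpret averaging_sequence m F G f \<epsilon>
  proof
    show "G \<in> bcontfun" using G by (intro bcontfun_discreteI[of _ 1]) simp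
    show "\<bar>f n x\<bar> \<le> 2" for n x using f[of n] by (simp add: S_def)
    show "expect \<nu> (f n) = expect \<nu> F" if "\<nu> \<in> invariant_means" for n \<nu>
      using f[of n] that by (simp add: S_def)
  qed (fact inv bS[OF FS] G ext cau ai \<epsilon>0 \<epsilon>1)+
  obtain c \<nu> where *: "\<nu> \<in> invariant_means" "0 \<le> c" "(\<lambda>n. meas m (superlevel n)) \<longlonglongrightarrow> c"
    "\<And>g. g \<in> bcontfun \<Longrightarrow> (\<lambda>n. expect m (\<lambda>x. g x * indicator (superlevel n) x)) \<longlonglongrightarrow> c * expect \<nu> g"
    "\<And>e. 0 < e \<Longrightarrow> \<exists>N. \<forall>n\<ge>N. \<forall>n'\<ge>N. meas m (sym_diff (superlevel n) (superlevel n')) < e"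
    "expect m F \<le> c * expect \<nu> F" "c * expect \<nu> G = 0"
    by (rule superlevel_restriction) blast
  show thesis by (rule that[OF *(1,3,4,5,2,6,7)])
qed

section \<open>Measures of sets and of cosets\<close>

lemma meas_nonneg: "is_mean m \<Longrightarrow> 0 \<le> meas m C"
  by (simp add: meas_eq_expect expect_nonneg bcontfun_indicator)

lemma meas_mono: "is_mean m \<Longrightarrow> C \<subseteq> D \<Longrightarrow> meas m C \<le> meas m D"
  unfolding meas_eq_expect
  by (intro expect_mono bcontfun_indicator) (auto simp: indicator_def)

lemma meas_le_1: "is_mean m \<Longrightarrow> meas m C \<le> 1"
  using meas_mono[of m C UNIV] by (simp add: is_mean_def meas_def)

lemma meas_coset:
  assumes "m \<in> invariant_means"
  shows "meas m (\<gamma> +o K) = meas m K"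
proof -
  have "x \<in> \<gamma> +o K \<longleftrightarrow> x - \<gamma> \<in> K" for x
    unfolding elt_set_plus_def by (auto intro: bexI[of _ "x - \<gamma>"])
  then have "indicator (\<gamma> +o K) = (\<lambda>x. indicator K (x - \<gamma>) :: real)"
    by (simp add: indicator_def fun_eq_iff)
  then show ?thesis
    using expect_shift[OF assms bcontfun_indicator, of K \<gamma>] by (simp add: meas_eq_expect)
qed

lemma mem_coset_iff:
  assumes "is_subgroup K"
  shows "x \<in> \<gamma> +o K \<longleftrightarrow> \<gamma> +o K = x +o K"
proof
  assume "x \<in> \<gamma> +o K"
  then obtain a where a: "a \<in> K" "x = \<gamma> + a" by (auto simp: elt_set_plus_def)
  have "a + b \<in> K" "- a + b \<in> K" if "b \<in> K" for b
    using assms a(1) that unfolding is_subgroup_def by blast+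
  then show "\<gamma> +o K = x +o K"
    unfolding elt_set_plus_def a(2)
    by (auto 0 3 simp: add.assoc intro: bexI[of _ "- a + _"])
next
  assume "\<gamma> +o K = x +o K"
  then show "x \<in> \<gamma> +o K"
    using assms by (auto simp: elt_set_plus_def is_subgroup_def intro: bexI[of _ 0])
qed

text \<open>The cosets partition the group, and invariance gives each of them the measure of
  \<open>K\<close>.\<close>

lemma card_cosets_mult_meas:
  assumes m: "m \<in> invariant_means" and K: "is_subgroup K" and fin: "finite (cosets K)"
  shows "real (card (cosets K)) * meas m K = 1"
proof -
  have "(\<Sum>X\<in>cosets K. indicator X x) = (1::real)" for x
  proof -
    have "cosets K \<inter> {X. x \<in> X} = {x +o K}"
      using mem_coset_iff[OF K] by (auto simp: cosets_def)
    then show ?thesis using fin by (simp add: indicator_def sum.If_cases)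
  qed
  then have "1 = expect m (\<lambda>x. \<Sum>X\<in>cosets K. indicator X x)"
    using invariant_means_is_mean[OF m] by simp
  also have "\<dots> = (\<Sum>X\<in>cosets K. meas m X)"
    unfolding meas_eq_expect by (rule expect_sum) (rule bcontfun_indicator)
  also have "\<dots> = (\<Sum>X\<in>cosets K. meas m K)"
    by (intro sum.cong refl) (auto simp: cosets_def meas_coset[OF m])
  finally show ?thesis by simp
qed

theorem theorem2p7:
  fixes A B K :: "'a::{ab_group_add,discrete_topology} set"
    and m :: "('a \<Rightarrow>\<^sub>C real) \<Rightarrow>\<^sub>L real"
    and k :: nat and \<delta> :: real
  assumes "A \<noteq> {}" and "B \<noteq> {}"
    and "is_subgroup K" and "finite (cosets K)"
    and "stabilizer (A + B + K) = K"
    and "\<And>\<nu>. \<nu> extreme_point_of invariant_means \<Longrightarrow>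
           meas \<nu> (A + B) < meas \<nu> A + meas \<nu> B \<Longrightarrow>
           meas \<nu> (A + B) = meas \<nu> (A + B + K) \<and>
           meas \<nu> (A + B + K) = meas \<nu> (A + K) + meas \<nu> (B + K) - meas \<nu> K"
    and "k = card (cosets K)"
    and "m \<in> invariant_means"
    and "\<delta> = meas m A + meas m B - meas m (A + B)"
    and "\<delta> > 0"
  shows "\<exists>m' \<in> invariant_means.
           is_restriction (real k * \<delta>) m m' \<and>
           meas m' (A + B) = meas m' (A + B + K) \<and>
           meas m' A + meas m' B - meas m' (A + B) \<ge> \<delta>"
proof -
  note K = assms(3) and fin = assms(4) and ext = assms(6) and k = assms(7) and inv = assms(8)
    and \<delta> = assms(9) and \<delta>0 = assms(10)
  note mean = invariant_means_is_mean[OF inv]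
  define F :: "'a \<Rightarrow> real" where "F x = indicator A x + indicator B x - indicator (A + B) x" for x
  define G :: "'a \<Rightarrow> real" where "G x = indicator (A + B + K) x - indicator (A + B) x" for x
  have subK: "X \<subseteq> X + K" for X :: "'a set"
    using K set_zero_plus2[of K X] by (simp add: is_subgroup_def add.commute)
  have EF: "expect \<nu> F = meas \<nu> A + meas \<nu> B - meas \<nu> (A + B)" for \<nu>
    unfolding F_def by (simp only: expect_diff[OF plus_cont[OF bcontfun_indicator bcontfun_indicator] bcontfun_indicator]
        expect_add[OF bcontfun_indicator bcontfun_indicator] meas_eq_expect)
  have EG: "expect \<nu> G = meas \<nu> (A + B + K) - meas \<nu> (A + B)" for \<nu>
    unfolding G_def by (simp only: expect_diff[OF bcontfun_indicator bcontfun_indicator] meas_eq_expect)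
  have F2: "\<bar>F x\<bar> \<le> 2" for x by (simp add: F_def indicator_def)
  have G01: "0 \<le> G x" "G x \<le> 1" for x
    using subK[of "A + B"] by (auto simp: G_def indicator_def)
  have bF: "F \<in> bcontfun" by (rule bcontfun_discreteI[OF F2])
  have kpos: "0 < real k"
    using card_cosets_mult_meas[OF inv K fin] k by (cases "k = 0") auto
  have F_le: "expect \<nu> F \<le> 1 / real k" if \<nu>: "\<nu> \<in> invariant_means" for \<nu>
  proof -
    have split: "expect \<mu> (\<lambda>x. 1 / real k - F x) = 1 / real k - expect \<mu> F"
      if "\<mu> \<in> invariant_means" for \<mu>
      by (simp only: expect_diff[OF const_bcontfun bF] expect_const[OF invariant_means_is_mean[OF that]])
    have "0 \<le> expect \<nu> (\<lambda>x. 1 / real k - F x)"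
    proof (rule expect_nonneg_of_extreme[OF \<nu> minus_cont[OF const_bcontfun bF]])
      fix \<mu> :: "('a \<Rightarrow>\<^sub>C real) \<Rightarrow>\<^sub>L real" assume \<mu>: "\<mu> extreme_point_of invariant_means"
      then have i\<mu>: "\<mu> \<in> invariant_means" by (simp add: extreme_point_of_def)
      note mean\<mu> = invariant_means_is_mean[OF i\<mu>]
      \<comment> \<open>If \<mu>(F) > 0, the hypothesis gives \<mu>(A+B) = \<mu>(A+K) + \<mu>(B+K) -
        \<mu>(K). As A and B lie in A+K and B+K, \<mu>(F) is at most \<mu>(K) = 1/k.\<close>
      have "expect \<mu> F \<le> 1 / real k"
      proof (cases "0 < expect \<mu> F")
        case True
        have "meas \<mu> K = 1 / real k"
          using card_cosets_mult_meas[OF i\<mu> K fin] k kpos by (simp add: field_simps)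
        moreover have "meas \<mu> A \<le> meas \<mu> (A + K)" "meas \<mu> B \<le> meas \<mu> (B + K)"
          by (intro meas_mono mean\<mu> subK)+
        ultimately show ?thesis using ext[OF \<mu>] True unfolding EF by linarith
      next
        case False
        have "0 \<le> 1 / real k" by simp
        with False show ?thesis by linarith
      qed
      then show "0 \<le> expect \<mu> (\<lambda>x. 1 / real k - F x)" unfolding split[OF i\<mu>] by simp
    qed
    then show ?thesis unfolding split[OF \<nu>] by simp
  qed
  have extFG: "expect \<nu> G = 0" if "\<nu> extreme_point_of invariant_means" "0 < expect \<nu> F" for \<nu>
    using ext[OF that(1)] that(2) unfolding EF EG by linarith
  obtain C c \<nu> where \<nu>: "\<nu> \<in> invariant_means" and c: "(\<lambda>n::nat. meas m (C n)) \<longlonglongrightarrow> c" "0 \<le> c"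
    and lim: "\<And>g. g \<in> bcontfun \<Longrightarrow> (\<lambda>n. expect m (\<lambda>x. g x * indicator (C n) x)) \<longlonglongrightarrow> c * expect \<nu> g"
    and cau: "\<And>e. 0 < e \<Longrightarrow> \<exists>N. \<forall>n\<ge>N. \<forall>n'\<ge>N. meas m (sym_diff (C n) (C n')) < e"
    and cF: "expect m F \<le> c * expect \<nu> F" and cG: "c * expect \<nu> G = 0"
    by (rule positive_restriction[of m F G, OF inv F2 G01]) (erule (1) extFG, rule that)
  have \<delta>F: "\<delta> \<le> c * expect \<nu> F" using cF by (simp add: EF \<delta>)
  with \<delta>0 have "0 < c * expect \<nu> F" by linarith
  then have cpos: "0 < c" and Fpos: "0 < expect \<nu> F" using c(2) by (auto simp: zero_less_mult_iff)
  \<comment> \<open>The inequality \<delta> \<le> c \<nu>(F) is used twice: with c \<le> 1 it gives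
    the third claim, and with \<nu>(F) \<le> 1/k it gives c \<ge> k \<delta>, the constant of the
    restriction.\<close>
  have "c \<le> 1"
    by (rule LIMSEQ_le_const2[OF c(1)]) (use meas_le_1[OF mean] in blast)
  then have "c * expect \<nu> F \<le> expect \<nu> F" using Fpos by (simp add: mult_left_le_one_le c(2))
  with \<delta>F have m'F: "\<delta> \<le> expect \<nu> F" by linarith
  have "\<delta> \<le> c * (1 / real k)"
    using \<delta>F mult_left_mono[OF F_le[OF \<nu>] c(2)] by linarith
  then have k\<delta>: "real k * \<delta> \<le> c" using kpos by (simp add: field_simps)
  have "is_restriction (real k * \<delta>) m \<nu>"
    unfolding is_restriction_def
  proof (intro conjI exI[of _ C] exI[of _ c] allI)
    show "0 < real k * \<delta>" using kpos \<delta>0 by simp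
    show "(\<lambda>n. inverse (meas m (C n)) * m (restrict_fun (C n) f)) \<longlonglongrightarrow> \<nu> f" for f
      using tendsto_mult[OF tendsto_inverse[OF c(1)] lim[OF apply_bcontfun[of f]]] cpos
      by (simp add: expect_restrict_fun mult.assoc[symmetric])
    show "(\<lambda>N. SUP (n, n') \<in> {N..} \<times> {N..}. meas m (sym_diff (C n) (C n'))) \<longlonglongrightarrow> 0"
    proof (rule LIMSEQ_I)
      fix e :: real assume e: "0 < e"
      let ?s = "\<lambda>p. case p of (n, n') \<Rightarrow> meas m (sym_diff (C n) (C n'))"
      \<comment> \<open>A supremum of values below e/2 is only known to be at most e/2; halving
        restores the strict bound e.\<close>
      obtain M where M: "\<And>n n'. n \<ge> M \<Longrightarrow> n' \<ge> M \<Longrightarrow> meas m (sym_diff (C n) (C n')) < e / 2"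
        using cau[of "e / 2"] e by auto
      have "norm ((SUP p \<in> {N..} \<times> {N..}. ?s p) - 0) < e" if N: "N \<ge> M" for N
      proof -
        have "(SUP p \<in> {N..} \<times> {N..}. ?s p) \<le> e / 2"
        proof (rule cSUP_least)
          show "?s p \<le> e / 2" if "p \<in> {N..} \<times> {N..}" for p
            using that N M by (auto intro!: less_imp_le)
        qed auto
        moreover have "0 \<le> (SUP p \<in> {N..} \<times> {N..}. ?s p)"
        proof (rule cSUP_upper2[of _ _ "(N, N)"])
          show "bdd_above (?s ` ({N..} \<times> {N..}))"
            by (intro bdd_aboveI2[of _ _ 1]) (auto intro: meas_le_1[OF mean])
        qed (auto intro: meas_nonneg[OF mean])
        ultimately show ?thesis using e by simp
      qed
      then show "\<exists>M. \<forall>N\<ge>M. norm ((SUP p \<in> {N..} \<times> {N..}. ?s p) - 0) < e" by blast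
    qed
  qed (fact c k\<delta> mean invariant_means_is_mean[OF \<nu>])+
  moreover have "meas \<nu> (A + B) = meas \<nu> (A + B + K)" using cG cpos by (simp add: EG)
  moreover have "\<delta> \<le> meas \<nu> A + meas \<nu> B - meas \<nu> (A + B)" using m'F by (simp add: EF)
  ultimately show ?thesis using \<nu> by blast
qed

end
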